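(* Let $m,n\ge 1$ be integers, $N=m+n$, let $H_1\in\mathbb{C}^{m\times m}$ and $H_2\in\mathbb{C}^{n\times n}$ be Hermitian, let $E\in\mathbb{C}^{n\times m}$, and set $$A=\begin{bmatrix} H_1 & E^* \\ E & H_2 \end{bmatrix},\qquad \widetilde A=\begin{bmatrix} H_1 & 0 \\ 0 & H_2 \end{bmatrix},\qquad V=A-\widetilde A=\begin{bmatrix} 0 & E^* \\ E & 0 \end{bmatrix}.$$ Let $\epsilon_2=\|E\|_2$ and $\eta=\min\{|\mu_1-\mu_2| : \mu_1\in\operatorname{eig}(H_1),\ \mu_2\in\operatorname{eig}(H_2)\}$. Then for every $Q$-norm $\|\cdot\|_Q$ on $\mathbb{C}^{N\times N}$, $$\big\|\operatorname{diag}\big(\lambda(A)-\lambda(\widetilde A)\big)\big\|_Q\le \phi(\eta,\epsilon_2)\,\|V\|_Q.$$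
   Context: $(\cdot)^*$ is the conjugate transpose, $\|\cdot\|_2$ is the spectral norm, and $\operatorname{eig}(X)$ is the multiset of eigenvalues of $X$. For a Hermitian $X\in\mathbb{C}^{N\times N}$, $\lambda(X)=[\lambda_1(X),\ldots,\lambda_N(X)]^{\mathrm T}\in\mathbb{R}^N$ is the vector of its eigenvalues counted with multiplicity and arranged in decreasing order $\lambda_1(X)\ge\cdots\ge\lambda_N(X)$. For a vector $x$, $\operatorname{diag}(x)$ is the diagonal matrix with the entries of $x$ on its diagonal, in order. For $\delta,\epsilon\ge 0$, $\phi(\delta,\epsilon)=\dfrac{2\epsilon}{\delta+\sqrt{\delta^2+4\epsilon^2}}$ if $(\delta,\epsilon)\ne(0,0)$, and $\phi(0,0)=1$. A unitarily invariant norm on $\mathbb{C}^{N\times N}$ is a norm with $\|UYW\|=\|Y\|$ for all $Y$ and all unitary $U,W$. A unitarily invariant norm $\|\cdot\|_Q$ on $\mathbb{C}^{N\times N}$ is called a $Q$-norm if there exists a unitarily invariant norm $\|\cdot\|'$ on $\mathbb{C}^{N\times N}$ such that $\|Y\|_Q=(\|Y^*Y\|')^{1/2}$ for all $Y\in\mathbb{C}^{N\times N}$. *)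

theory Defs
  imports
    "HOL-Analysis.L2_Norm"
    "Jordan_Normal_Form.Schur_Decomposition"
begin

definition hermitian_mat :: "complex mat \<Rightarrow> bool" where
  "hermitian_mat X \<longleftrightarrow> square_mat X \<and> mat_adjoint X = X"

definition unitary_mat :: "nat \<Rightarrow> complex mat \<Rightarrow> bool" where
  "unitary_mat N U \<longleftrightarrow> U \<in> carrier_mat N N \<and>
     mat_adjoint U * U = 1\<^sub>m N \<and> U * mat_adjoint U = 1\<^sub>m N"

definition eig :: "complex mat \<Rightarrow> complex multiset" where
  "eig X = proots (char_poly X)"

text \<open>Meaningful for Hermitian arguments, whose eigenvalues are real, so that \<open>Re\<close> only changes
  the type. The entries are indexed from 0.\<close>

definition eig_vec :: "complex mat \<Rightarrow> real vec" where
  "eig_vec X = vec_of_list (rev (sorted_list_of_multiset (image_mset Re (eig X))))"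

definition diag_of_vec :: "real vec \<Rightarrow> complex mat" where
  "diag_of_vec x = mat_diag (dim_vec x) (\<lambda>i. complex_of_real (x $ i))"

definition vec_norm2 :: "complex vec \<Rightarrow> real" where
  "vec_norm2 x = L2_set (\<lambda>i. cmod (x $ i)) {..<dim_vec x}"

text \<open>The supremum is over a nonempty set only if \<open>dim_col Y > 0\<close>.\<close>

definition spectral_norm :: "complex mat \<Rightarrow> real" where
  "spectral_norm Y =
     (SUP x\<in>{x \<in> carrier_vec (dim_col Y). vec_norm2 x = 1}. vec_norm2 (Y *\<^sub>v x))"

text \<open>\<open>Min\<close> is meaningful only if both multisets are nonempty, i.e. both matrices have
  positive dimension.\<close>

definition eig_gap :: "complex mat \<Rightarrow> complex mat \<Rightarrow> real" where
  "eig_gap X Y = Min {cmod (\<mu>\<^sub>1 - \<mu>\<^sub>2) | \<mu>\<^sub>1 \<mu>\<^sub>2. \<mu>\<^sub>1 \<in># eig X \<and> \<mu>\<^sub>2 \<in># eig Y}"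

definition phi :: "real \<Rightarrow> real \<Rightarrow> real" where
  "phi \<delta> \<epsilon> =
     (if (\<delta>, \<epsilon>) = (0, 0) then 1 else 2 * \<epsilon> / (\<delta> + sqrt (\<delta>\<^sup>2 + 4 * \<epsilon>\<^sup>2)))"

text \<open>Norms on the complex \<open>N \<times> N\<close> matrices are functions on all matrices, constrained only on
  \<open>carrier_mat N N\<close>.\<close>

definition matrix_norm :: "nat \<Rightarrow> (complex mat \<Rightarrow> real) \<Rightarrow> bool" where
  "matrix_norm N \<nu> \<longleftrightarrow>
     (\<forall>Y\<in>carrier_mat N N. 0 \<le> \<nu> Y \<and> (\<nu> Y = 0 \<longleftrightarrow> Y = 0\<^sub>m N N)) \<and>
     (\<forall>c. \<forall>Y\<in>carrier_mat N N. \<nu> (c \<cdot>\<^sub>m Y) = cmod c * \<nu> Y) \<and>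
     (\<forall>Y\<in>carrier_mat N N. \<forall>Z\<in>carrier_mat N N. \<nu> (Y + Z) \<le> \<nu> Y + \<nu> Z)"

definition unitarily_invariant_norm :: "nat \<Rightarrow> (complex mat \<Rightarrow> real) \<Rightarrow> bool" where
  "unitarily_invariant_norm N \<nu> \<longleftrightarrow> matrix_norm N \<nu> \<and>
     (\<forall>Y\<in>carrier_mat N N. \<forall>U W. unitary_mat N U \<and> unitary_mat N W \<longrightarrow> \<nu> (U * Y * W) = \<nu> Y)"

definition Q_norm :: "nat \<Rightarrow> (complex mat \<Rightarrow> real) \<Rightarrow> bool" where
  "Q_norm N \<nu> \<longleftrightarrow> unitarily_invariant_norm N \<nu> \<and>
     (\<exists>\<nu>'. unitarily_invariant_norm N \<nu>' \<and>
        (\<forall>Y\<in>carrier_mat N N. \<nu> Y = sqrt (\<nu>' (mat_adjoint Y * Y))))"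

end

theory Submission
  imports Defs
begin

text \<open>Put \<open>A(t) = A' + t V\<close>. If \<open>v = (x, y)\<close> is a unit eigenvector of \<open>A(t)\<close> for the
  eigenvalue \<open>\<mu>(t)\<close>, then \<open>\<mu>'(t) = v* V v = 2 Re (y* E x)\<close>. Averaging the squared distances
  between the spectra of \<open>H\<^sub>1\<close> and \<open>H\<^sub>2\<close> against the spectral measures at \<open>x\<close> and \<open>y\<close> turns the gap
  \<open>\<eta>\<close> into the bound \<open>\<bar>v* V v\<bar> \<le> \<psi>(t) \<parallel>V v\<parallel>\<close>, where
  \<open>\<psi>(t) = 2 t \<epsilon>\<^sub>2 / sqrt (\<eta>\<^sup>2 + 4 t\<^sup>2 \<epsilon>\<^sub>2\<^sup>2)\<close>. For an eigenbasis \<open>v\<^sub>i\<close> the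
  numbers \<open>\<parallel>V v\<^sub>i\<parallel>\<^sup>2\<close> are the diagonal of a matrix unitarily similar to \<open>V* V\<close>, so pinching bounds the
  \<open>Q\<close>-norm of the vector of derivatives by \<open>\<psi>(t) \<parallel>V\<parallel>\<^sub>Q\<close>. Integrating over \<open>[0, 1]\<close> gives the theorem,
  because the integral of \<open>\<psi>\<close> is \<open>\<phi>(\<eta>, \<epsilon>\<^sub>2)\<close>.\<close>

section \<open>Unitary diagonalization\<close>

text \<open>Sorted eigenvalues need not be differentiable where they cross, and at a degenerate
  eigenvalue an arbitrary eigenbasis does not give their rates of change. So no derivative of an
  eigenvalue is taken: difference quotients are followed only along subsequences, where compactness
  of the unitary group supplies some eigenbasis of A(t), and the norm bound is proved for every
  eigenbasis, so that it does not matter which one occurs. Likewise the integral is replaced by a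
  bisection argument that turns local increment bounds with slack \<delta> into the increment of an
  antiderivative. The gap \<eta> belongs to the fixed blocks, not to A(t). It can be used because
  the two block rows of the eigenvalue equation express \<open>H1 x\<close> and \<open>H2 y\<close>
  by x, y and the coupling terms; the eigenvalue of A(t) then cancels from the averaged squared
  distances. For \<eta> = 0 the formula for \<psi> is 0/0 at t = 0; there the Cauchy-Schwarz
  inequality supplies the constant 1, the value of \<phi> at \<eta> = 0.\<close>

lemma mat_adjoint_dim [simp]:
  "dim_row (mat_adjoint A) = dim_col A" "dim_col (mat_adjoint A) = dim_row A"
  by (auto simp: mat_adjoint_def)

lemma mat_adjoint_carrier [simp, intro]:
  "A \<in> carrier_mat n m \<Longrightarrow> mat_adjoint A \<in> carrier_mat m n"
  by auto

lemma mat_adjoint_index [simp]: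
  fixes A :: "complex mat"
  assumes "i < dim_col A" "j < dim_row A"
  shows "mat_adjoint A $$ (i, j) = cnj (A $$ (j, i))"
  using assms by (auto simp: mat_adjoint_def mat_of_rows_def)

lemma mat_adjoint_adjoint [simp]:
  fixes A :: "complex mat"
  shows "mat_adjoint (mat_adjoint A) = A"
  by (rule eq_matI) auto

lemma mat_adjoint_mult:
  fixes A B :: "complex mat"
  assumes "A \<in> carrier_mat n m" "B \<in> carrier_mat m k"
  shows "mat_adjoint (A * B) = mat_adjoint B * mat_adjoint A"
  using assms by (intro eq_matI) (auto simp: scalar_prod_def mult.commute)

lemma mult_carrier_square [simp]:
  "A \<in> carrier_mat n n \<Longrightarrow> B \<in> carrier_mat n n \<Longrightarrow> A * B \<in> carrier_mat n n"
  by (rule mult_carrier_mat)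

lemma mat_adjoint_one [simp]: "mat_adjoint (1\<^sub>m n :: complex mat) = 1\<^sub>m n"
  by (rule eq_matI) auto

lemma mat_adjoint_mat_diag [simp]:
  "mat_adjoint (mat_diag n f :: complex mat) = mat_diag n (\<lambda>i. cnj (f i))"
  by (rule eq_matI) (auto simp: mat_diag_def)

lemma mat_adjoint_four_block:
  fixes A B C D :: "complex mat"
  assumes "A \<in> carrier_mat n m" "B \<in> carrier_mat n l" "C \<in> carrier_mat k m" "D \<in> carrier_mat k l"
  shows "mat_adjoint (four_block_mat A B C D) =
    four_block_mat (mat_adjoint A) (mat_adjoint C) (mat_adjoint B) (mat_adjoint D)"
  using assms by (intro eq_matI) auto

lemma mat_adjoint_add_smult:
  fixes A V :: "complex mat"
  assumes A: "A \<in> carrier_mat n n" "mat_adjoint A = A"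
    and V: "V \<in> carrier_mat n n" "mat_adjoint V = V"
  shows "mat_adjoint (A + of_real t \<cdot>\<^sub>m V) = A + of_real t \<cdot>\<^sub>m V"
proof (rule eq_matI)
  fix i j assume ij: "i < dim_row (A + of_real t \<cdot>\<^sub>m V)" "j < dim_col (A + of_real t \<cdot>\<^sub>m V)"
  then have "cnj (A $$ (j,i)) = A $$ (i,j)" "cnj (V $$ (j,i)) = V $$ (i,j)"
    using A V mat_adjoint_index[of i A j] mat_adjoint_index[of i V j] by auto
  then show "mat_adjoint (A + of_real t \<cdot>\<^sub>m V) $$ (i,j) = (A + of_real t \<cdot>\<^sub>m V) $$ (i,j)"
    using ij A V by simp
qed (use A V in auto)

lemma mat_adjoint_inner:
  fixes A :: "complex mat"
  assumes "A \<in> carrier_mat n m" "x \<in> carrier_vec m" "y \<in> carrier_vec n"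
  shows "(A *\<^sub>v x) \<bullet>c y = x \<bullet>c (mat_adjoint A *\<^sub>v y)"
proof -
  have "(A *\<^sub>v x) \<bullet>c y = (\<Sum>i<n. \<Sum>j<m. A $$ (i,j) * x $ j * cnj (y $ i))"
    using assms by (simp add: scalar_prod_def sum_distrib_right atLeast0LessThan)
  also have "\<dots> = (\<Sum>j<m. \<Sum>i<n. A $$ (i,j) * x $ j * cnj (y $ i))"
    by (rule sum.swap)
  also have "\<dots> = x \<bullet>c (mat_adjoint A *\<^sub>v y)"
    using assms by (simp add: scalar_prod_def sum_distrib_left atLeast0LessThan mult_ac)
  finally show ?thesis .
qed

lemma hermitian_matD:
  assumes "hermitian_mat A" "A \<in> carrier_mat n n"
  shows "mat_adjoint A = A"
  using assms by (auto simp: hermitian_mat_def)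

lemma unitary_matD:
  assumes "unitary_mat N U"
  shows "U \<in> carrier_mat N N" "mat_adjoint U \<in> carrier_mat N N"
    "mat_adjoint U * U = 1\<^sub>m N" "U * mat_adjoint U = 1\<^sub>m N"
  using assms by (auto simp: unitary_mat_def)

lemma unitary_matI:
  assumes U: "U \<in> carrier_mat N N" and UU: "mat_adjoint U * U = 1\<^sub>m N"
  shows "unitary_mat N U"
  using mat_mult_left_right_inverse[OF _ U UU] assms by (auto simp: unitary_mat_def)

lemma unitary_mat_adjoint:
  assumes "unitary_mat N U"
  shows "unitary_mat N (mat_adjoint U)"
  using assms by (auto simp: unitary_mat_def)

lemma unitary_mat_mult:
  assumes "unitary_mat N U" "unitary_mat N W"
  shows "unitary_mat N (U * W)"
proof (rule unitary_matI)
  note U = unitary_matD[OF assms(1)] and W = unitary_matD[OF assms(2)]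
  show "U * W \<in> carrier_mat N N" using U W by auto
  have "mat_adjoint (U * W) * (U * W) = mat_adjoint W * (mat_adjoint U * U) * W"
    using U(1,2) W(1,2) by (simp add: mat_adjoint_mult assoc_mult_mat[of _ N N _ N _ N])
  then show "mat_adjoint (U * W) * (U * W) = 1\<^sub>m N" using U W by simp
qed

lemma unitary_mat_diag:
  assumes "\<And>i. i < N \<Longrightarrow> cmod (f i) = 1"
  shows "unitary_mat N (mat_diag N f)"
proof (rule unitary_matI)
  have "cnj (f i) * f i = 1" if "i < N" for i
    using assms[OF that] by (simp add: complex_norm_square[symmetric] mult.commute)
  then show "mat_adjoint (mat_diag N f) * mat_diag N f = 1\<^sub>m N"
    by (simp, intro eq_matI) (auto simp: mat_diag_def)
qed simp

lemma unitary_similar: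
  assumes "unitary_mat N U" "A \<in> carrier_mat N N"
  shows "similar_mat A (mat_adjoint U * A * U)"
  unfolding similar_mat_def
proof (intro exI, rule similar_mat_witI[of _ _ N])
  note U = unitary_matD[OF assms(1)]
  show "U * mat_adjoint U = 1\<^sub>m N" "mat_adjoint U * U = 1\<^sub>m N" using U by auto
  have "U * (mat_adjoint U * A * U) * mat_adjoint U =
      (U * mat_adjoint U) * A * (U * mat_adjoint U)"
    using U(1,2) assms(2) by (simp add: assoc_mult_mat[of _ N N _ N _ N])
  also have "\<dots> = A" using U(3,4) assms(2) by simp
  finally show "A = U * (mat_adjoint U * A * U) * mat_adjoint U" ..
qed (use assms unitary_matD[OF assms(1)] in auto)

section \<open>Euclidean norm, inner product and completion to a unitary matrix\<close>

lemma scalar_prod_self_complex: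
  fixes v :: "complex vec"
  shows "v \<bullet>c v = of_real (\<Sum>i<dim_vec v. (cmod (v $ i))\<^sup>2)"
  by (simp add: scalar_prod_def atLeast0LessThan complex_norm_square del: of_real_power)

lemma vec_norm2_square: "(vec_norm2 v)\<^sup>2 = (\<Sum>i<dim_vec v. (cmod (v $ i))\<^sup>2)"
  by (simp add: vec_norm2_def L2_set_def sum_nonneg)

lemma vec_norm2_inner: "v \<bullet>c v = of_real ((vec_norm2 v)\<^sup>2)"
  by (simp add: scalar_prod_self_complex vec_norm2_square del: of_real_power)

lemma vec_norm2_nonneg [simp]: "0 \<le> vec_norm2 v"
  by (simp add: vec_norm2_def)

lemma Cauchy_Schwarz_complex_vec:
  assumes "x \<in> carrier_vec n" "y \<in> carrier_vec n"
  shows "cmod (x \<bullet>c y) \<le> vec_norm2 x * vec_norm2 y"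
proof -
  have "cmod (x \<bullet>c y) \<le> (\<Sum>i<n. cmod (x $ i) * cmod (y $ i))"
    using assms by (auto simp: scalar_prod_def atLeast0LessThan norm_mult intro!: sum_norm_le)
  also have "\<dots> = (\<Sum>i<n. \<bar>cmod (x $ i)\<bar> * \<bar>cmod (y $ i)\<bar>)" by simp
  also have "\<dots> \<le> L2_set (\<lambda>i. cmod (x $ i)) {..<n} * L2_set (\<lambda>i. cmod (y $ i)) {..<n}"
    by (rule L2_set_mult_ineq)
  finally show ?thesis using assms by (simp add: vec_norm2_def)
qed

text \<open>Gram-Schmidt on a basis that starts with \<open>v\<close> leaves \<open>v\<close> in
  first place and produces orthogonal vectors that are not normalized. Dividing each by its length
  gives unitary columns, which is why column 0 is only a multiple of \<open>v\<close>.\<close>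

lemma unitary_completion:
  fixes v :: "complex vec"
  assumes v: "v \<in> carrier_vec n" and v0: "v \<noteq> 0\<^sub>v n"
  obtains W c where "unitary_mat n W" "col W 0 = c \<cdot>\<^sub>v v"
proof -
  interpret cof_vec_space n "TYPE(complex)" .
  define b where "b = basis_completion v"
  define ws where "ws = gram_schmidt n b"
  from basis_completion[OF v v0, folded b_def]
  have dist_b: "distinct b" and indep: "\<not> lin_dep (set b)" and b: "set b \<subseteq> carrier_vec n"
    and hdb: "hd b = v" and len_b: "length b = n" by auto
  have n: "n > 0" using v v0 by (cases n) auto
  from hdb len_b n obtain vs where bv: "b = v # vs" by (cases b) auto
  from gram_schmidt_result[OF b dist_b indep refl, folded ws_def]
  have ws: "set ws \<subseteq> carrier_vec n" "corthogonal ws" "length ws = n" by (auto simp: len_b)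
  from gram_schmidt_hd[OF v, of vs, folded bv] have hdws: "hd ws = v" unfolding ws_def .
  have wsc: "ws ! j \<in> carrier_vec n" if "j < n" for j using that ws by auto
  define r where "r j = 1 / vec_norm2 (ws ! j)" for j
  define W where "W = mat n n (\<lambda>(i,j). of_real (r j) * ws ! j $ i)"
  have inner: "(mat_adjoint W * W) $$ (i,j) = of_real (r i * r j) * (ws ! j \<bullet>c ws ! i)"
    if "i < n" "j < n" for i j
    using that wsc[OF that(1)] wsc[OF that(2)]
    by (simp add: W_def scalar_prod_def sum_distrib_left mult_ac)
  have "unitary_mat n W"
  proof (rule unitary_matI)
    show "mat_adjoint W * W = 1\<^sub>m n"
    proof (rule eq_matI)
      fix i j assume ij: "i < dim_row (1\<^sub>m n)" "j < dim_col (1\<^sub>m n)"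
      show "(mat_adjoint W * W) $$ (i,j) = 1\<^sub>m n $$ (i,j)"
      proof (cases "i = j")
        case True
        have "vec_norm2 (ws ! i) \<noteq> 0"
          using corthogonalD[OF ws(2), of i i] ij ws(3) by (simp add: vec_norm2_inner)
        then show ?thesis using True ij inner[of i j]
          by (simp add: vec_norm2_inner r_def power2_eq_square)
      next
        case False
        then show ?thesis using ij inner[of i j] corthogonalD[OF ws(2), of j i] ws(3) by simp
      qed
    qed (auto simp: W_def)
  qed (simp add: W_def)
  moreover have hd0: "ws ! 0 = v" using hdws ws(3) n by (cases ws) auto
  have "col W 0 = of_real (r 0) \<cdot>\<^sub>v v"
    using hd0 ws(3) n v by (intro eq_vecI) (auto simp: W_def)
  ultimately show ?thesis by (rule that)
qed

lemma adjoint_conj_hermitian: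
  fixes A W :: "complex mat"
  assumes A: "A \<in> carrier_mat n n" "mat_adjoint A = A" and W: "W \<in> carrier_mat n k"
  shows "mat_adjoint (mat_adjoint W * A * W) = mat_adjoint W * A * W"
proof -
  have WA: "mat_adjoint W * A \<in> carrier_mat k n" using A(1) W by auto
  have "mat_adjoint (mat_adjoint W * A * W) = mat_adjoint W * (mat_adjoint A * W)"
    using A(1) W WA by (simp add: mat_adjoint_mult[of _ k n _ k] mat_adjoint_mult[of _ k n _ n])
  then show ?thesis using A W by (simp add: assoc_mult_mat[of _ k n _ n _ k])
qed

lemma adjoint_conj_mult:
  fixes A W P :: "complex mat"
  assumes "W \<in> carrier_mat n n" "P \<in> carrier_mat n n" "A \<in> carrier_mat n n"
  shows "mat_adjoint (W * P) * A * (W * P) = mat_adjoint P * (mat_adjoint W * A * W) * P"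
  using assms by (simp add: mat_adjoint_mult[of _ n n _ n] assoc_mult_mat[of _ n n _ n _ n])

text \<open>A unitary matrix whose first column is an eigenvector turns the first column of
  \<open>A\<close> into \<open>e\<close> followed by zeros. Hermitian symmetry, which conjugation
  preserves, then clears the first row and passes to the remaining block.\<close>

lemma hermitian_deflate:
  fixes A :: "complex mat"
  assumes A: "A \<in> carrier_mat n n" "mat_adjoint A = A" and e: "eigenvalue A e"
  obtains W B where "unitary_mat n W" "B \<in> carrier_mat (n - 1) (n - 1)" "mat_adjoint B = B"
    "mat_adjoint W * A * W = four_block_mat (mat 1 1 (\<lambda>_. e)) (0\<^sub>m 1 (n - 1)) (0\<^sub>m (n - 1) 1) B"
    "n > 0"
proof -
  obtain v where v: "v \<in> carrier_vec n" "v \<noteq> 0\<^sub>v n" "A *\<^sub>v v = e \<cdot>\<^sub>v v"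
    using e A by (auto simp: eigenvalue_def eigenvector_def)
  have n: "n > 0" using v by (cases n) auto
  obtain W c where W: "unitary_mat n W" and W0: "col W 0 = c \<cdot>\<^sub>v v"
    by (rule unitary_completion[OF v(1,2)])
  note Wc = unitary_matD[OF W]
  define M where "M = mat_adjoint W * A * W"
  have M: "M \<in> carrier_mat n n" using Wc A by (auto simp: M_def)
  have Ma: "mat_adjoint M = M" unfolding M_def by (rule adjoint_conj_hermitian) (use A Wc in auto)
  have col0: "M $$ (i,0) = (if i = 0 then e else 0)" if i: "i < n" for i
  proof -
    have "M $$ (i,0) = (mat_adjoint W * (A * W)) $$ (i,0)"
      using Wc A by (simp add: M_def assoc_mult_mat[of _ n n _ n _ n])
    also have "\<dots> = row (mat_adjoint W) i \<bullet> (A *\<^sub>v col W 0)"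
      using i n Wc A by (simp flip: col_mult2[of _ n n _ n])
    also have "A *\<^sub>v col W 0 = e \<cdot>\<^sub>v col W 0"
      unfolding W0 using v A by (simp add: mult_mat_vec[of _ n n] smult_smult_assoc mult.commute)
    also have "row (mat_adjoint W) i \<bullet> (e \<cdot>\<^sub>v col W 0) = e * (mat_adjoint W * W) $$ (i,0)"
      using i n Wc(1) by simp
    also have "(mat_adjoint W * W) $$ (i,0) = (if i = 0 then 1 else 0)"
      unfolding Wc(3) using i n by simp
    finally show ?thesis by simp
  qed
  have row0: "M $$ (0,i) = 0" if "i < n" "i \<noteq> 0" for i
  proof -
    have "M $$ (0,i) = mat_adjoint M $$ (0,i)" by (simp add: Ma)
    also have "\<dots> = cnj (M $$ (i,0))" using M that n by simp
    finally show ?thesis using col0[OF that(1)] that by simp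
  qed
  define B where "B = mat (n - 1) (n - 1) (\<lambda>(i,j). M $$ (i + 1, j + 1))"
  have "mat_adjoint B = B"
  proof (rule eq_matI)
    fix i j assume ij: "i < dim_row B" "j < dim_col B"
    then have "cnj (M $$ (j + 1, i + 1)) = mat_adjoint M $$ (i + 1, j + 1)"
      using M by (simp add: B_def)
    then show "mat_adjoint B $$ (i,j) = B $$ (i,j)" using ij by (simp add: B_def Ma)
  qed (auto simp: B_def)
  moreover have "M = four_block_mat (mat 1 1 (\<lambda>_. e)) (0\<^sub>m 1 (n - 1)) (0\<^sub>m (n - 1) 1) B"
    using M n by (intro eq_matI) (auto simp: B_def col0 row0)
  moreover have "B \<in> carrier_mat (n - 1) (n - 1)" by (simp add: B_def)
  ultimately show ?thesis using that[OF W] n unfolding M_def by blast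
qed

text \<open>The induction runs over the list of roots, so the diagonal comes out in the order of
  that list. A sorted diagonalization then needs no permutation matrices: it suffices to factor the
  characteristic polynomial along a sorted list.\<close>

lemma hermitian_diagonalize:
  fixes A :: "complex mat"
  assumes "A \<in> carrier_mat n n" "mat_adjoint A = A" "char_poly A = (\<Prod>e\<leftarrow>es. [:- e, 1:])"
  shows "\<exists>U. unitary_mat n U \<and> mat_adjoint U * A * U = mat_diag n (\<lambda>i. es ! i)"
  using assms
proof (induction es arbitrary: n A)
  case Nil
  then have "n = 0" using degree_monic_char_poly[OF Nil(1)] by simp
  then show ?case using Nil(1)
    by (intro exI[of _ "1\<^sub>m n"]) (auto simp: unitary_mat_def mat_diag_def)
next
  case (Cons e es n A)
  have e: "eigenvalue A e" unfolding eigenvalue_root_char_poly[OF Cons(2)] Cons(4) by simp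
  obtain W B where W: "unitary_mat n W" and B: "B \<in> carrier_mat (n - 1) (n - 1)" "mat_adjoint B = B"
    and WAW: "mat_adjoint W * A * W =
      four_block_mat (mat 1 1 (\<lambda>_. e)) (0\<^sub>m 1 (n - 1)) (0\<^sub>m (n - 1) 1) B" and n: "n > 0"
    by (rule hermitian_deflate[OF Cons(2,3) e])
  note Wc = unitary_matD[OF W]
  let ?E = "mat 1 1 (\<lambda>_. e)" and ?k = "n - 1"
  have "[:- e, 1:] * (\<Prod>e\<leftarrow>es. [:- e, 1:]) = char_poly ?E * char_poly B"
    using char_poly_similar[OF unitary_similar[OF W Cons(2)]] Cons(4)
      char_poly_four_block_zeros_col[OF _ zero_carrier_mat B(1), of ?E] by (simp add: WAW)
  also have "char_poly ?E = [:- e, 1:]" by (simp add: char_poly_defs det_def sign_def)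
  finally have "char_poly B = (\<Prod>e\<leftarrow>es. [:- e, 1:])"
    by (metis mult_cancel_left pCons_eq_0_iff zero_neq_one)
  from Cons(1)[OF B this] obtain U where U: "unitary_mat ?k U"
    and UBU: "mat_adjoint U * B * U = mat_diag ?k (\<lambda>i. es ! i)" by blast
  note Uc = unitary_matD[OF U]
  let ?O = "1\<^sub>m 1 :: complex mat" and ?Z = "0\<^sub>m 1 ?k :: complex mat" and ?Z' = "0\<^sub>m ?k 1 :: complex mat"
  let ?P = "four_block_mat ?O ?Z ?Z' U"
  have Pa: "mat_adjoint ?P = four_block_mat ?O ?Z ?Z' (mat_adjoint U)"
    using Uc n by (intro eq_matI) auto
  have P: "?P \<in> carrier_mat n n" using Uc n by auto
  have unit: "unitary_mat n ?P"
  proof (rule unitary_matI[OF P])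
    have "mat_adjoint ?P * ?P = four_block_mat ?O ?Z ?Z' (1\<^sub>m ?k)"
      unfolding Pa using Uc
      by (subst mult_four_block_mat[of _ 1 1 _ ?k _ ?k _ _ 1 _ ?k]) auto
    then show "mat_adjoint ?P * ?P = 1\<^sub>m n" using n by (simp add: four_block_one_mat)
  qed
  have "mat_adjoint (W * ?P) * A * (W * ?P) = mat_adjoint ?P * (mat_adjoint W * A * W) * ?P"
    by (rule adjoint_conj_mult[OF Wc(1) P Cons(2)])
  also have "\<dots> = four_block_mat ?E ?Z ?Z' (mat_adjoint U * B) * ?P"
    unfolding Pa WAW using Uc B
    by (subst mult_four_block_mat[of _ 1 1 _ ?k _ ?k _ _ 1 _ ?k]) auto
  also have "\<dots> = four_block_mat ?E ?Z ?Z' (mat_diag ?k (\<lambda>i. es ! i))"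
    using Uc B UBU
    by (subst mult_four_block_mat[of _ 1 1 _ ?k _ ?k _ _ 1 _ ?k]) auto
  also have "\<dots> = mat_diag n (\<lambda>i. (e # es) ! i)"
    using n by (intro eq_matI) (auto simp: mat_diag_def nth_Cons')
  finally show ?case using unitary_mat_mult[OF W unit] by blast
qed

section \<open>Sorted eigenvalues and unitarily invariant norms\<close>

lemma proots_linear_factors:
  fixes es :: "complex list"
  shows "proots (\<Prod>e\<leftarrow>es. [:- e, 1:]) = mset es"
proof (induction es)
  case (Cons e es)
  have "(\<Prod>e\<leftarrow>es. [:- e, 1:]) \<noteq> 0" by (auto simp: prod_list_zero_iff)
  then have "proots ([:- e, 1:] * (\<Prod>e\<leftarrow>es. [:- e, 1:])) = add_mset e (mset es)"
    using Cons by (subst proots_mult) (auto simp del: mult_pCons_left)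
  then show ?case by simp
qed simp

lemma eig_unitary_diag:
  assumes "A \<in> carrier_mat n n" "unitary_mat n U" "mat_adjoint U * A * U = mat_diag n f"
  shows "eig A = mset (map f [0..<n])"
proof -
  have "char_poly A = char_poly (mat_diag n f)"
    using char_poly_similar[OF unitary_similar[OF assms(2,1)]] assms(3) by simp
  also have "\<dots> = (\<Prod>a\<leftarrow>diag_mat (mat_diag n f). [:- a, 1:])"
    by (rule char_poly_upper_triangular[of _ n]) (auto simp: mat_diag_def)
  also have "diag_mat (mat_diag n f) = map f [0..<n]"
    by (auto simp: diag_mat_def mat_diag_def)
  finally show ?thesis unfolding eig_def by (simp only: proots_linear_factors)
qed

text \<open>Recognizes the sorted spectrum from any decreasing unitary diagonalization. Its main use
  is for limits of diagonalizations, where the limit has to be identified with the spectrum of the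
  limit matrix.\<close>

lemma eig_vec_unique:
  assumes "A \<in> carrier_mat n n" "unitary_mat n U"
    "mat_adjoint U * A * U = mat_diag n (\<lambda>i. complex_of_real (f i))"
    and dec: "\<And>i j. i \<le> j \<Longrightarrow> j < n \<Longrightarrow> f j \<le> f i"
  shows "eig_vec A = vec n f"
proof -
  let ?xs = "rev (map f [0..<n])"
  have srt: "sorted ?xs"
    using dec by (auto simp: sorted_rev_iff_nth_mono)
  have "image_mset Re (eig A) = mset (map f [0..<n])"
    unfolding eig_unitary_diag[OF assms(1-3)] by (simp add: multiset.map_comp o_def)
  also have "\<dots> = mset ?xs" by (simp only: mset_rev)
  finally have "sorted_list_of_multiset (image_mset Re (eig A)) = ?xs"
    using srt by (simp add: sorted_sort_id del: mset_rev mset_map)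
  then have "eig_vec A = vec_of_list (map f [0..<n])"
    by (simp add: eig_vec_def)
  then show ?thesis by (auto intro!: eq_vecI simp: vec_of_list_index)
qed

text \<open>A first diagonalization in arbitrary order shows that the roots are real, because a
  diagonal Hermitian matrix equals its conjugate. Once they are real they can be sorted, and a
  second diagonalization follows the sorted list.\<close>

lemma hermitian_eig_vec:
  assumes A: "A \<in> carrier_mat n n" "mat_adjoint A = A"
  obtains U where "unitary_mat n U" "mat_adjoint U * A * U = diag_of_vec (eig_vec A)"
    "dim_vec (eig_vec A) = n"
    "\<And>i j. i \<le> j \<Longrightarrow> j < n \<Longrightarrow> eig_vec A $ j \<le> eig_vec A $ i"
proof -
  obtain as where as: "char_poly A = (\<Prod>a\<leftarrow>as. [:- a, 1:])" "length as = n"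
    using char_poly_factorized[OF A(1)] by blast
  obtain U0 where U0: "unitary_mat n U0" "mat_adjoint U0 * A * U0 = mat_diag n (\<lambda>i. as ! i)"
    using hermitian_diagonalize[OF A as(1)] by blast
  have "mat_adjoint (mat_diag n (\<lambda>i. as ! i)) = mat_diag n (\<lambda>i. as ! i)"
    using adjoint_conj_hermitian[OF A unitary_matD(1)[OF U0(1)]] U0(2) by simp
  then have "cnj (as ! i) = as ! i" if "i < n" for i
    using that by (auto simp: mat_diag_def dest!: arg_cong[of _ _ "\<lambda>M. M $$ (i,i)"])
  then have real: "of_real (Re (as ! i)) = as ! i" if "i < n" for i
    using that by (metis Reals_cnj_iff of_real_Re)
  define rs where "rs = rev (sort (map Re as))"
  have len: "length rs = n" by (simp add: rs_def as)
  have "mset (map complex_of_real rs) = image_mset (\<lambda>a. of_real (Re a)) (mset as)"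
    by (simp add: rs_def multiset.map_comp o_def)
  also have "\<dots> = image_mset id (mset as)"
    using real as(2) by (intro image_mset_cong) (auto simp: in_set_conv_nth)
  finally have ms: "mset (map complex_of_real rs) = mset as" by simp
  \<comment> \<open>The product of linear factors depends only on the multiset of roots, so it may
    be rewritten along the sorted list.\<close>
  have "char_poly A = prod_mset (image_mset (\<lambda>a. [:- a, 1:]) (mset as))"
    unfolding as(1) by (simp flip: prod_mset_prod_list)
  also have "\<dots> = (\<Prod>a\<leftarrow>map complex_of_real rs. [:- a, 1:])"
    unfolding ms[symmetric] by (simp flip: prod_mset_prod_list add: multiset.map_comp o_def)
  finally have "char_poly A = (\<Prod>a\<leftarrow>map complex_of_real rs. [:- a, 1:])" .
  from hermitian_diagonalize[OF A this] obtain U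
    where U: "unitary_mat n U"
      and D: "mat_adjoint U * A * U = mat_diag n (\<lambda>i. map complex_of_real rs ! i)" by blast
  have D: "mat_adjoint U * A * U = mat_diag n (\<lambda>i. complex_of_real (rs ! i))"
    unfolding D using len by (intro eq_matI) (auto simp: mat_diag_def)
  have dec: "rs ! j \<le> rs ! i" if "i \<le> j" "j < n" for i j
    using that len by (auto simp: rs_def rev_nth intro!: sorted_nth_mono)
  have ev: "eig_vec A = vec n (\<lambda>i. rs ! i)"
    by (rule eig_vec_unique[OF A(1) U D]) (use dec in auto)
  show ?thesis
  proof (rule that[OF U])
    show "mat_adjoint U * A * U = diag_of_vec (eig_vec A)"
      unfolding D ev by (intro eq_matI) (auto simp: mat_diag_def diag_of_vec_def)
  qed (use dec ev in auto)
qed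

lemma mat_diag_cong:
  assumes "\<And>i. i < n \<Longrightarrow> f i = g i"
  shows "mat_diag n f = mat_diag n g"
  using assms by (intro eq_matI) (auto simp: mat_diag_def)

section \<open>Unitarily invariant norms on diagonal matrices\<close>

lemma unitarily_invariant_normD:
  assumes "unitarily_invariant_norm N \<nu>"
  shows "\<And>Y. Y \<in> carrier_mat N N \<Longrightarrow> 0 \<le> \<nu> Y"
    "\<nu> (0\<^sub>m N N) = 0"
    "\<And>c Y. Y \<in> carrier_mat N N \<Longrightarrow> \<nu> (c \<cdot>\<^sub>m Y) = cmod c * \<nu> Y"
    "\<And>Y Z. Y \<in> carrier_mat N N \<Longrightarrow> Z \<in> carrier_mat N N \<Longrightarrow> \<nu> (Y + Z) \<le> \<nu> Y + \<nu> Z"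
    "\<And>Y U W. Y \<in> carrier_mat N N \<Longrightarrow> unitary_mat N U \<Longrightarrow> unitary_mat N W \<Longrightarrow> \<nu> (U * Y * W) = \<nu> Y"
  using assms unfolding unitarily_invariant_norm_def matrix_norm_def by auto

text \<open>The reflection in one coordinate: being unitary, it does not change the norm, and
  averaging with it alters a matrix one coordinate at a time.\<close>

definition flip_sign :: "nat \<Rightarrow> nat \<Rightarrow> complex mat" where
  "flip_sign N k = mat_diag N (\<lambda>i. if i = k then -1 else 1)"

lemma unitary_flip_sign: "unitary_mat N (flip_sign N k)"
  unfolding flip_sign_def by (rule unitary_mat_diag) auto

text \<open>The mean of a matrix and its conjugate by \<open>flip_sign N k\<close> keeps the
  diagonal and clears the other entries of row and column k. By the triangle inequality and unitary
  invariance its norm is no larger. Repeating this for every k leaves only the diagonal.\<close>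

lemma pinching:
  assumes inv: "unitarily_invariant_norm N \<nu>" and Y: "Y \<in> carrier_mat N N"
  shows "\<nu> (mat_diag N (\<lambda>i. Y $$ (i,i))) \<le> \<nu> Y"
proof -
  note \<nu> = unitarily_invariant_normD[OF inv]
  define Z where "Z k = mat N N (\<lambda>(i,j). if i \<noteq> j \<and> (i < k \<or> j < k) then 0 else Y $$ (i,j))" for k
  have "\<nu> (Z k) \<le> \<nu> Y" for k
  proof (induction k)
    case 0
    have "Z 0 = Y" using Y by (intro eq_matI) (auto simp: Z_def)
    then show ?case by simp
  next
    case (Suc k)
    let ?S = "flip_sign N k"
    have Z: "Z k \<in> carrier_mat N N" and S: "?S \<in> carrier_mat N N"
      by (auto simp: Z_def flip_sign_def)
    have SZS: "?S * Z k * ?S = mat N N (\<lambda>(i,j). (if i = k then -1 else 1) * (Z k $$ (i,j) * (if j = k then -1 else 1)))"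
      using Z S unfolding flip_sign_def
      by (subst mat_diag_mult_right[of _ N], simp, subst mat_diag_mult_left[of _ N N]) (auto intro!: eq_matI)
    have "Z (Suc k) = (1/2) \<cdot>\<^sub>m (Z k + ?S * Z k * ?S)"
      unfolding SZS by (intro eq_matI) (auto simp: Z_def less_Suc_eq)
    also have "\<nu> \<dots> = (1/2) * \<nu> (Z k + ?S * Z k * ?S)"
      using Z S by (subst \<nu>(3)) auto
    also have "\<dots> \<le> (1/2) * (\<nu> (Z k) + \<nu> (?S * Z k * ?S))"
      using Z S by (intro mult_left_mono \<nu>(4)) auto
    also have "\<nu> (?S * Z k * ?S) = \<nu> (Z k)"
      using Z by (intro \<nu>(5) unitary_flip_sign)
    finally show ?case using Suc by simp
  qed
  moreover have "Z N = mat_diag N (\<lambda>i. Y $$ (i,i))"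
    by (intro eq_matI) (auto simp: Z_def mat_diag_def)
  ultimately show ?thesis by metis
qed

text \<open>The entries of \<open>g\<close> are replaced by those of \<open>f\<close> one at a time.
  Scaling a single entry by a factor in [-1, 1] is a convex combination of the matrix and its image
  under a sign flip, both of the same norm.\<close>

lemma norm_mat_diag_mono:
  assumes inv: "unitarily_invariant_norm N \<nu>"
    and le: "\<And>i. i < N \<Longrightarrow> \<bar>f i\<bar> \<le> g i"
  shows "\<nu> (mat_diag N (\<lambda>i. complex_of_real (f i))) \<le> \<nu> (mat_diag N (\<lambda>i. complex_of_real (g i)))"
proof -
  note \<nu> = unitarily_invariant_normD[OF inv]
  define H where "H k = mat_diag N (\<lambda>i. complex_of_real (if i < k then f i else g i))" for k
  have le0: "\<nu> (H k) \<le> \<nu> (H 0)" if "k \<le> N" for k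
    using that
  proof (induction k)
    case (Suc k)
    obtain \<theta> where \<theta>: "\<bar>\<theta>\<bar> \<le> 1" "f k = \<theta> * g k"
    proof (cases "g k = 0")
      case True
      then show ?thesis using le[of k] Suc.prems that[of 0] by auto
    next
      case False
      then show ?thesis using le[of k] Suc.prems that[of "f k / g k"] by (auto simp: abs_div)
    qed
    let ?S = "flip_sign N k"
    \<comment> \<open>The two weights are nonnegative with sum 1 and difference \<theta>: entry k is
      multiplied by \<theta> and all other entries stay.\<close>
    let ?a = "complex_of_real ((1 + \<theta>) / 2)" and ?b = "complex_of_real ((1 - \<theta>) / 2)"
    have Hc: "H k \<in> carrier_mat N N" and S: "?S \<in> carrier_mat N N"
      by (auto simp: H_def flip_sign_def)
    have SH: "\<nu> (?S * H k) = \<nu> (H k)"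
    proof -
      have "\<nu> (?S * H k * 1\<^sub>m N) = \<nu> (H k)"
        using Hc by (intro \<nu>(5) unitary_flip_sign) (auto simp: unitary_mat_def)
      then show ?thesis using Hc S by (simp add: right_mult_one_mat[of _ N N])
    qed
    have "H (Suc k) = ?a \<cdot>\<^sub>m H k + ?b \<cdot>\<^sub>m (?S * H k)"
      using Suc.prems \<theta> unfolding H_def flip_sign_def mat_diag_diag
      by (intro eq_matI) (auto simp: mat_diag_def field_simps less_Suc_eq)
    also have "\<nu> \<dots> \<le> \<nu> (?a \<cdot>\<^sub>m H k) + \<nu> (?b \<cdot>\<^sub>m (?S * H k))"
      using Hc S by (intro \<nu>(4)) auto
    also have "\<dots> = cmod ?a * \<nu> (H k) + cmod ?b * \<nu> (H k)"
      using Hc S by (simp only: \<nu>(3) mult_carrier_square SH)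
    also have "\<dots> = \<nu> (H k)"
      using \<theta>(1) by (simp only: norm_of_real) (simp add: field_simps abs_if split: if_splits)
    finally show ?case using Suc by simp
  qed simp
  have "H N = mat_diag N (\<lambda>i. complex_of_real (f i))"
    unfolding H_def by (rule mat_diag_cong) simp
  moreover have "H 0 = mat_diag N (\<lambda>i. complex_of_real (g i))" by (simp add: H_def)
  ultimately show ?thesis using le0[of N] by simp
qed

text \<open>Serves as continuity of the norm on diagonal matrices: entries tending to 0 force the
  norm to tend to 0.\<close>

lemma norm_mat_diag_le_sum:
  assumes inv: "unitarily_invariant_norm N \<nu>"
  shows "\<nu> (mat_diag N f) \<le> (\<Sum>i<N. cmod (f i) * \<nu> (mat_diag N (\<lambda>j. if j = i then 1 else 0)))"
proof -
  note \<nu> = unitarily_invariant_normD[OF inv]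
  let ?E = "\<lambda>i. mat_diag N (\<lambda>j. if j = i then 1 else 0 :: complex)"
  have le: "\<nu> (mat_diag N (\<lambda>j. if j < k then f j else 0)) \<le> (\<Sum>i<k. cmod (f i) * \<nu> (?E i))" for k
  proof (induction k)
    case 0
    have "mat_diag N (\<lambda>j. if j < 0 then f j else 0) = 0\<^sub>m N N"
      by (intro eq_matI) (auto simp: mat_diag_def)
    then show ?case using \<nu>(2) by simp
  next
    case (Suc k)
    have "mat_diag N (\<lambda>j. if j < Suc k then f j else 0) =
        mat_diag N (\<lambda>j. if j < k then f j else 0) + f k \<cdot>\<^sub>m ?E k"
      by (intro eq_matI) (auto simp: mat_diag_def less_Suc_eq)
    then have "\<nu> (mat_diag N (\<lambda>j. if j < Suc k then f j else 0)) \<le>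
        \<nu> (mat_diag N (\<lambda>j. if j < k then f j else 0)) + \<nu> (f k \<cdot>\<^sub>m ?E k)"
      using \<nu>(4) by simp
    then show ?case using Suc by (simp add: \<nu>(3))
  qed
  have "mat_diag N (\<lambda>j. if j < N then f j else 0) = mat_diag N f"
    by (rule mat_diag_cong) simp
  then show ?thesis using le[of N] by simp
qed

section \<open>Spectral gap and off-diagonal coupling\<close>

lemma Re_inner:
  assumes "x \<in> carrier_vec n" "y \<in> carrier_vec n"
  shows "Re (x \<bullet>c y) = (\<Sum>i<n. Re (x $ i) * Re (y $ i) + Im (x $ i) * Im (y $ i))"
  using assms by (simp add: scalar_prod_def atLeast0LessThan)

lemma Re_inner_commute:
  assumes "x \<in> carrier_vec n" "y \<in> carrier_vec n"
  shows "Re (x \<bullet>c y) = Re (y \<bullet>c x)"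
  by (simp add: Re_inner[OF assms] Re_inner[OF assms(2,1)] mult.commute)

lemma Re_inner_self: "Re (x \<bullet>c x) = (vec_norm2 x)\<^sup>2"
  by (simp add: vec_norm2_inner del: of_real_power)

lemma vec_norm2_diff_square:
  assumes "x \<in> carrier_vec n" "u \<in> carrier_vec n"
  shows "(vec_norm2 (of_real a \<cdot>\<^sub>v x - of_real b \<cdot>\<^sub>v u))\<^sup>2 =
    a\<^sup>2 * (vec_norm2 x)\<^sup>2 + b\<^sup>2 * (vec_norm2 u)\<^sup>2 - 2 * a * b * Re (x \<bullet>c u)"
proof -
  have "(vec_norm2 (of_real a \<cdot>\<^sub>v x - of_real b \<cdot>\<^sub>v u))\<^sup>2 =
      (\<Sum>i<n. (cmod (of_real a * x $ i - of_real b * u $ i))\<^sup>2)"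
    using assms unfolding vec_norm2_square by (intro sum.cong) auto
  also have "\<dots> = (\<Sum>i<n. a\<^sup>2 * (cmod (x $ i))\<^sup>2 + b\<^sup>2 * (cmod (u $ i))\<^sup>2 -
      2 * a * b * (Re (x $ i) * Re (u $ i) + Im (x $ i) * Im (u $ i)))"
    by (rule sum.cong[OF refl], unfold cmod_power2) (simp add: power2_eq_square algebra_simps)
  also have "\<dots> = a\<^sup>2 * (\<Sum>i<n. (cmod (x $ i))\<^sup>2) + b\<^sup>2 * (\<Sum>i<n. (cmod (u $ i))\<^sup>2) -
      2 * a * b * (\<Sum>i<n. Re (x $ i) * Re (u $ i) + Im (x $ i) * Im (u $ i))"
    by (simp only: sum_subtractf sum.distrib[of "\<lambda>i. a\<^sup>2 * _ i"] sum_distrib_left)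
  finally show ?thesis using assms by (simp add: vec_norm2_square Re_inner[OF assms])
qed

lemma Re_inner_diff:
  assumes "x \<in> carrier_vec n" "u \<in> carrier_vec n" "z \<in> carrier_vec n"
  shows "Re ((of_real a \<cdot>\<^sub>v x - of_real b \<cdot>\<^sub>v u) \<bullet>c z) = a * Re (x \<bullet>c z) - b * Re (u \<bullet>c z)"
proof -
  have xu: "of_real a \<cdot>\<^sub>v x - of_real b \<cdot>\<^sub>v u \<in> carrier_vec n" using assms by simp
  have "Re ((of_real a \<cdot>\<^sub>v x - of_real b \<cdot>\<^sub>v u) \<bullet>c z) =
      (\<Sum>i<n. a * (Re (x $ i) * Re (z $ i) + Im (x $ i) * Im (z $ i)) -
        b * (Re (u $ i) * Re (z $ i) + Im (u $ i) * Im (z $ i)))"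
    unfolding Re_inner[OF xu assms(3)] using assms
    by (intro sum.cong) (auto simp: algebra_simps)
  then show ?thesis
    by (simp only: sum_subtractf sum_distrib_left[symmetric] Re_inner[OF assms(1,3)] Re_inner[OF assms(2,3)])
qed

lemma vec_norm2_smult: "vec_norm2 (c \<cdot>\<^sub>v x) = cmod c * vec_norm2 x"
proof -
  have "vec_norm2 (c \<cdot>\<^sub>v x) = L2_set (\<lambda>i. cmod c * cmod (x $ i)) {..<dim_vec x}"
    unfolding vec_norm2_def by (intro L2_set_cong) (auto simp: norm_mult)
  then show ?thesis by (simp add: vec_norm2_def L2_set_right_distrib)
qed

lemma vec_norm2_eq_0D:
  assumes "x \<in> carrier_vec n" "vec_norm2 x = 0"
  shows "x = 0\<^sub>v n"
  using assms by (intro eq_vecI) (auto simp: vec_norm2_def L2_set_eq_0_iff)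

lemma vec_norm2_zero [simp]: "vec_norm2 (0\<^sub>v n) = 0"
  by (simp add: vec_norm2_def L2_set_def)

section \<open>The spectral norm as an operator bound\<close>

lemma vec_norm2_mult_le_spectral_norm:
  assumes E: "E \<in> carrier_mat n m" and x: "x \<in> carrier_vec m"
  shows "vec_norm2 (E *\<^sub>v x) \<le> spectral_norm E * vec_norm2 x"
proof (cases "vec_norm2 x = 0")
  case True
  then have "E *\<^sub>v x = 0\<^sub>v n" using vec_norm2_eq_0D[OF x] E by (intro eq_vecI) auto
  then show ?thesis using True by simp
next
  case False
  let ?X = "{x \<in> carrier_vec (dim_col E). vec_norm2 x = 1}"
  define u where "u = of_real (1 / vec_norm2 x) \<cdot>\<^sub>v x"
  have u: "u \<in> ?X" using False x E by (simp add: u_def vec_norm2_smult norm_divide)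
  \<comment> \<open>A real supremum dominates its set only if that set is bounded above; the sum of
    the moduli of all entries of \<open>E\<close> is a crude bound on the unit sphere.\<close>
  have bdd: "bdd_above ((\<lambda>x. vec_norm2 (E *\<^sub>v x)) ` ?X)"
  proof (rule bdd_aboveI2)
    fix z assume z: "z \<in> ?X"
    have "dim_vec z = m" using z E by auto
    then have z1: "L2_set (\<lambda>i. cmod (z $ i)) {..<m} = 1" using z by (simp add: vec_norm2_def)
    have zj: "cmod (z $ j) \<le> 1" if "j < m" for j
      using member_le_L2_set[of "{..<m}" j "\<lambda>i. cmod (z $ i)"] that by (simp add: z1)
    have "vec_norm2 (E *\<^sub>v z) \<le> (\<Sum>i<n. \<bar>cmod ((E *\<^sub>v z) $ i)\<bar>)"
      using E L2_set_le_sum_abs[of "\<lambda>i. cmod ((E *\<^sub>v z) $ i)" "{..<n}"] by (simp add: vec_norm2_def)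
    also have "\<dots> \<le> (\<Sum>i<n. \<Sum>j<m. cmod (E $$ (i,j)))"
    proof (rule sum_mono)
      fix i assume i: "i \<in> {..<n}"
      have "cmod ((E *\<^sub>v z) $ i) \<le> (\<Sum>j<m. cmod (E $$ (i,j)) * cmod (z $ j))"
        using i E z by (auto simp: scalar_prod_def atLeast0LessThan norm_mult intro!: sum_norm_le)
      also have "\<dots> \<le> (\<Sum>j<m. cmod (E $$ (i,j)))"
        using zj by (intro sum_mono mult_left_le) auto
      finally show "\<bar>cmod ((E *\<^sub>v z) $ i)\<bar> \<le> (\<Sum>j<m. cmod (E $$ (i,j)))" by simp
    qed
    finally show "vec_norm2 (E *\<^sub>v z) \<le> (\<Sum>i<n. \<Sum>j<m. cmod (E $$ (i,j)))" .
  qed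
  have "vec_norm2 (E *\<^sub>v u) \<le> spectral_norm E"
    unfolding spectral_norm_def by (rule cSUP_upper[OF u bdd])
  moreover have "E *\<^sub>v u = of_real (1 / vec_norm2 x) \<cdot>\<^sub>v (E *\<^sub>v x)"
    unfolding u_def by (rule mult_mat_vec[OF E x])
  ultimately have "vec_norm2 (E *\<^sub>v x) / vec_norm2 x \<le> spectral_norm E"
    by (simp add: vec_norm2_smult norm_divide)
  moreover have "0 < vec_norm2 x" using False vec_norm2_nonneg[of x] by linarith
  ultimately show ?thesis by (simp only: pos_divide_le_eq)
qed

lemma spectral_norm_nonneg:
  assumes "E \<in> carrier_mat n m" "m > 0"
  shows "0 \<le> spectral_norm E"
proof -
  have "vec_norm2 (unit_vec m 0) = 1"
  proof -
    have "(vec_norm2 (unit_vec m 0))\<^sup>2 = (\<Sum>i<m. if i = 0 then 1 else 0)"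
      unfolding vec_norm2_square by (intro sum.cong) auto
    also have "\<dots> = 1" using assms(2) by simp
    finally have "\<bar>vec_norm2 (unit_vec m 0)\<bar> = 1" by (simp only: abs_square_eq_1)
    then show ?thesis by simp
  qed
  then have "vec_norm2 (E *\<^sub>v unit_vec m 0) \<le> spectral_norm E"
    using vec_norm2_mult_le_spectral_norm[OF assms(1) unit_vec_carrier[of m 0]] by simp
  then show ?thesis by (rule order_trans[OF vec_norm2_nonneg])
qed

text \<open>With u the image of y under the adjoint, the square of the norm of u is the inner
  product of \<open>E u\<close> with y, hence at most the spectral norm times the norms of u and y.
  One factor, the norm of u, cancels. The spectral norm of \<open>E\<close> itself thus bounds both
  off-diagonal blocks.\<close>

lemma vec_norm2_adjoint_mult_le_spectral_norm:
  assumes E: "E \<in> carrier_mat n m" and m: "m > 0" and y: "y \<in> carrier_vec n"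
  shows "vec_norm2 (mat_adjoint E *\<^sub>v y) \<le> spectral_norm E * vec_norm2 y"
proof (cases "vec_norm2 (mat_adjoint E *\<^sub>v y) = 0")
  case True
  then show ?thesis using spectral_norm_nonneg[OF E m] by simp
next
  case False
  let ?u = "mat_adjoint E *\<^sub>v y"
  have u: "?u \<in> carrier_vec m" by (rule mult_mat_vec_carrier[OF mat_adjoint_carrier[OF E] y])
  have "(vec_norm2 ?u)\<^sup>2 = Re (?u \<bullet>c ?u)" by (simp add: Re_inner_self)
  also have "\<dots> = Re ((E *\<^sub>v ?u) \<bullet>c y)"
    using mat_adjoint_inner[OF E u y] by simp
  also have "\<dots> \<le> cmod ((E *\<^sub>v ?u) \<bullet>c y)" by (rule complex_Re_le_cmod)
  also have "\<dots> \<le> vec_norm2 (E *\<^sub>v ?u) * vec_norm2 y"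
    using E u y by (intro Cauchy_Schwarz_complex_vec) auto
  also have "\<dots> \<le> spectral_norm E * vec_norm2 ?u * vec_norm2 y"
    by (intro mult_right_mono vec_norm2_mult_le_spectral_norm[OF E u]) simp
  finally have "vec_norm2 ?u * vec_norm2 ?u \<le> vec_norm2 ?u * (spectral_norm E * vec_norm2 y)"
    by (simp add: power2_eq_square mult_ac)
  moreover have "0 < vec_norm2 ?u" using False vec_norm2_nonneg[of ?u] by linarith
  ultimately show ?thesis by (simp only: mult_le_cancel_left_pos)
qed

lemma vec_norm2_unitary:
  assumes U: "unitary_mat n U" and x: "x \<in> carrier_vec n"
  shows "vec_norm2 (U *\<^sub>v x) = vec_norm2 x"
proof -
  note Uc = unitary_matD[OF U]
  have "(U *\<^sub>v x) \<bullet>c (U *\<^sub>v x) = x \<bullet>c (mat_adjoint U *\<^sub>v (U *\<^sub>v x))"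
    using Uc x by (intro mat_adjoint_inner[of _ n n]) auto
  also have "mat_adjoint U *\<^sub>v (U *\<^sub>v x) = x"
    using Uc x by (simp flip: assoc_mult_mat_vec[of _ n n _ n])
  finally have "(vec_norm2 (U *\<^sub>v x))\<^sup>2 = (vec_norm2 x)\<^sup>2"
    by (simp flip: Re_inner_self)
  then show ?thesis by simp
qed

text \<open>The numbers \<open>w i\<close> are the spectral measure of \<open>H\<close> at \<open>x\<close>.\<close>

lemma spectral_weights:
  assumes H: "H \<in> carrier_mat n n" "mat_adjoint H = H" and x: "x \<in> carrier_vec n"
  obtains w h :: "nat \<Rightarrow> real" where "\<And>i. i < n \<Longrightarrow> 0 \<le> w i"
    "\<And>i. i < n \<Longrightarrow> of_real (h i) \<in># eig H"
    "(vec_norm2 x)\<^sup>2 = (\<Sum>i<n. w i)"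
    "Re ((H *\<^sub>v x) \<bullet>c x) = (\<Sum>i<n. h i * w i)"
    "(vec_norm2 (H *\<^sub>v x))\<^sup>2 = (\<Sum>i<n. (h i)\<^sup>2 * w i)"
proof -
  obtain U where U: "unitary_mat n U" and D: "mat_adjoint U * H * U = diag_of_vec (eig_vec H)"
    and dim: "dim_vec (eig_vec H) = n"
    by (rule hermitian_eig_vec[OF H])
  note Uc = unitary_matD[OF U] and U' = unitary_mat_adjoint[OF U]
  define h where "h i = eig_vec H $ i" for i
  define z where "z = mat_adjoint U *\<^sub>v x"
  have z: "z \<in> carrier_vec n" unfolding z_def by (rule mult_mat_vec_carrier[OF Uc(2) x])
  have Uz: "U *\<^sub>v z = x"
    using Uc x by (simp add: z_def flip: assoc_mult_mat_vec[of _ n n _ n])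
  have D': "mat_adjoint U * H * U = mat_diag n (\<lambda>i. of_real (h i))"
    unfolding D diag_of_vec_def dim h_def ..
  have Hx: "H *\<^sub>v x \<in> carrier_vec n" using H x by simp
  \<comment> \<open>In the eigenbasis coordinates \<open>z\<close> of \<open>x\<close>, the matrix
    \<open>H\<close> acts by multiplying each coordinate with its eigenvalue.\<close>
  have "mat_adjoint U *\<^sub>v (H *\<^sub>v x) = (mat_adjoint U * H * U) *\<^sub>v z"
    using Uc(1,2) H(1) z x by (simp add: assoc_mult_mat_vec[of _ n n _ n] Uz)
  then have UHx: "mat_adjoint U *\<^sub>v (H *\<^sub>v x) = vec n (\<lambda>i. of_real (h i) * z $ i)"
    unfolding D' using z
    by (intro eq_vecI) (auto simp: mat_diag_def scalar_prod_def if_distrib[of "\<lambda>a. a * _"] cong: if_cong)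
  show ?thesis
  proof (rule that[of "\<lambda>i. (cmod (z $ i))\<^sup>2" h])
    show "of_real (h i) \<in># eig H" if "i < n" for i
      unfolding eig_unitary_diag[OF H(1) U D'] using that by auto
    have "(vec_norm2 x)\<^sup>2 = (vec_norm2 z)\<^sup>2"
      unfolding z_def by (simp add: vec_norm2_unitary[OF U' x])
    then show "(vec_norm2 x)\<^sup>2 = (\<Sum>i<n. (cmod (z $ i))\<^sup>2)"
      using z by (simp add: vec_norm2_square)
    have "(H *\<^sub>v x) \<bullet>c x = (mat_adjoint U *\<^sub>v (H *\<^sub>v x)) \<bullet>c z"
      using mat_adjoint_inner[OF Uc(2) Hx z] Uz by simp
    then have "Re ((H *\<^sub>v x) \<bullet>c x) =
        (\<Sum>i<n. h i * Re (z $ i) * Re (z $ i) + h i * Im (z $ i) * Im (z $ i))"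
      using z by (simp add: UHx Re_inner[of _ n])
    then show "Re ((H *\<^sub>v x) \<bullet>c x) = (\<Sum>i<n. h i * (cmod (z $ i))\<^sup>2)"
      unfolding cmod_power2 by (simp add: power2_eq_square algebra_simps)
    have "(vec_norm2 (H *\<^sub>v x))\<^sup>2 = (vec_norm2 (mat_adjoint U *\<^sub>v (H *\<^sub>v x)))\<^sup>2"
      by (simp add: vec_norm2_unitary[OF U' Hx])
    then show "(vec_norm2 (H *\<^sub>v x))\<^sup>2 = (\<Sum>i<n. (h i)\<^sup>2 * (cmod (z $ i))\<^sup>2)"
      by (simp add: UHx vec_norm2_square norm_mult power_mult_distrib)
  qed simp
qed

text \<open>The right side is the mean of \<open>(h i - k j)\<^sup>2\<close> under the product of
  the two spectral measures: expanding the square gives second moments times total masses, minus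
  twice the product of the first moments. Each squared distance is at least
  \<open>\<eta>\<^sup>2\<close>, in whatever way the two spectra interlace.\<close>

lemma spectral_gap_ineq:
  assumes H1: "H1 \<in> carrier_mat m m" "mat_adjoint H1 = H1" and x: "x \<in> carrier_vec m"
    and H2: "H2 \<in> carrier_mat n n" "mat_adjoint H2 = H2" and y: "y \<in> carrier_vec n"
    and gap: "\<And>\<mu> \<nu>. \<mu> \<in># eig H1 \<Longrightarrow> \<nu> \<in># eig H2 \<Longrightarrow> \<eta> \<le> cmod (\<mu> - \<nu>)" and \<eta>: "0 \<le> \<eta>"
  shows "\<eta>\<^sup>2 * (vec_norm2 x)\<^sup>2 * (vec_norm2 y)\<^sup>2 \<le>
    (vec_norm2 (H1 *\<^sub>v x))\<^sup>2 * (vec_norm2 y)\<^sup>2 + (vec_norm2 x)\<^sup>2 * (vec_norm2 (H2 *\<^sub>v y))\<^sup>2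
      - 2 * Re ((H1 *\<^sub>v x) \<bullet>c x) * Re ((H2 *\<^sub>v y) \<bullet>c y)"
proof -
  obtain w h where w: "\<And>i. i < m \<Longrightarrow> 0 \<le> w i" and h: "\<And>i. i < m \<Longrightarrow> of_real (h i) \<in># eig H1"
    and x_eq: "(vec_norm2 x)\<^sup>2 = (\<Sum>i<m. w i)"
      "Re ((H1 *\<^sub>v x) \<bullet>c x) = (\<Sum>i<m. h i * w i)"
      "(vec_norm2 (H1 *\<^sub>v x))\<^sup>2 = (\<Sum>i<m. (h i)\<^sup>2 * w i)"
    using spectral_weights[OF H1 x] by blast
  obtain v k where v: "\<And>i. i < n \<Longrightarrow> 0 \<le> v i" and k: "\<And>i. i < n \<Longrightarrow> of_real (k i) \<in># eig H2"
    and y_eq: "(vec_norm2 y)\<^sup>2 = (\<Sum>i<n. v i)"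
      "Re ((H2 *\<^sub>v y) \<bullet>c y) = (\<Sum>i<n. k i * v i)"
      "(vec_norm2 (H2 *\<^sub>v y))\<^sup>2 = (\<Sum>i<n. (k i)\<^sup>2 * v i)"
    using spectral_weights[OF H2 y] by blast
  have sq: "\<eta>\<^sup>2 \<le> (h i - k j)\<^sup>2" if "i < m" "j < n" for i j
  proof -
    have "\<eta> \<le> cmod (of_real (h i) - of_real (k j))" by (rule gap[OF h[OF that(1)] k[OF that(2)]])
    also have "\<dots> = \<bar>h i - k j\<bar>" by (simp flip: of_real_diff)
    finally show ?thesis using \<eta> by (metis abs_le_square_iff abs_of_nonneg)
  qed
  have "\<eta>\<^sup>2 * (vec_norm2 x)\<^sup>2 * (vec_norm2 y)\<^sup>2 = (\<Sum>i<m. \<Sum>j<n. \<eta>\<^sup>2 * (w i * v j))"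
    unfolding x_eq y_eq mult.assoc sum_product by (simp add: sum_distrib_left)
  also have "\<dots> \<le> (\<Sum>i<m. \<Sum>j<n. (h i - k j)\<^sup>2 * (w i * v j))"
    using w v by (intro sum_mono mult_right_mono sq) auto
  also have "\<dots> = (\<Sum>i<m. \<Sum>j<n. (h i)\<^sup>2 * w i * v j + w i * ((k j)\<^sup>2 * v j) - 2 * (h i * w i * (k j * v j)))"
    by (simp add: power2_diff algebra_simps)
  also have "\<dots> = (\<Sum>i<m. (h i)\<^sup>2 * w i) * (\<Sum>j<n. v j) + (\<Sum>i<m. w i) * (\<Sum>j<n. (k j)\<^sup>2 * v j)
      - 2 * ((\<Sum>i<m. h i * w i) * (\<Sum>j<n. k j * v j))"
    unfolding sum_product by (simp add: sum.distrib sum_subtractf sum_distrib_left)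
  finally show ?thesis by (simp add: x_eq y_eq mult.assoc)
qed

text \<open>The scalar core of the coupling bound. P and Q stand for the squared norms of the two
  parts of the unit eigenvector, a and b for those of the two parts of its image under
  \<open>V\<close>, r for the squared real coupling, and e for the spectral norm. Once normalized by
  e, P and Q, the gap inequality reduces the claim to an inequality that is affine in \<alpha> and
  \<beta>, with coefficients of a fixed sign. The extreme case is therefore \<alpha> = \<beta> =
  \<sigma>, where the difference of the two sides is \<sigma> (1 - \<sigma>) (P - Q)^2.\<close>

lemma rotation_angle_bound:
  fixes P Q a b r \<eta> t e :: real
  assumes PQ: "0 \<le> P" "0 \<le> Q" "P + Q = 1"
    and gap: "P * Q * \<eta>\<^sup>2 \<le> t\<^sup>2 * (a * Q + b * P - 2 * r)"
    and r: "0 \<le> r" "r \<le> P * a" "r \<le> Q * b"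
    and ab: "a \<le> e\<^sup>2 * Q" "b \<le> e\<^sup>2 * P" "0 \<le> a" "0 \<le> b"
  shows "r * (\<eta>\<^sup>2 + 4 * t\<^sup>2 * e\<^sup>2) \<le> t\<^sup>2 * e\<^sup>2 * (a + b)"
proof (cases "P = 0 \<or> Q = 0 \<or> e = 0")
  case True
  then have "r = 0" using r ab by auto
  then show ?thesis using ab by simp
next
  case False
  then have pos: "0 < P" "0 < Q" "0 < e\<^sup>2" using PQ by auto
  \<comment> \<open>Each quantity is divided by its largest possible value, so that all the bounds
    become \<sigma> \<le> \<alpha>, \<sigma> \<le> \<beta> and \<alpha> \<le> 1.\<close>
  define \<alpha> \<beta> \<sigma> where "\<alpha> = a / (e\<^sup>2 * Q)" and "\<beta> = b / (e\<^sup>2 * P)" and "\<sigma> = r / (e\<^sup>2 * P * Q)"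
  have eqs: "a = e\<^sup>2 * Q * \<alpha>" "b = e\<^sup>2 * P * \<beta>" "r = e\<^sup>2 * P * Q * \<sigma>"
    using pos by (auto simp: \<alpha>_def \<beta>_def \<sigma>_def)
  have \<sigma>0: "0 \<le> \<sigma>" using pos r by (simp add: \<sigma>_def)
  have \<sigma>\<alpha>: "\<sigma> \<le> \<alpha>" using r(2) pos unfolding eqs by (simp add: mult_ac)
  have \<sigma>\<beta>: "\<sigma> \<le> \<beta>" using r(3) pos unfolding eqs by (simp add: mult_ac)
  have \<alpha>1: "\<alpha> \<le> 1" using ab(1) pos unfolding eqs by simp
  have \<sigma>1: "\<sigma> \<le> 1" using \<sigma>\<alpha> \<alpha>1 by simp
  have PQ1: "P \<le> 1" "Q \<le> 1" using PQ by auto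
  have s: "\<sigma> * Q \<le> 1" "\<sigma> * P \<le> 1"
    using \<sigma>1 \<sigma>0 PQ1 PQ by (auto intro: mult_le_one)
  \<comment> \<open>This is the extreme case \<alpha> = \<beta> = \<sigma>; the identity that
    follows needs P + Q = 1. Raising \<sigma> to \<alpha> and \<beta> in the two leading terms then
    only enlarges the expression, since \<sigma> Q and \<sigma> P are at most 1.\<close>
  have "0 \<le> \<sigma> * ((P - Q)\<^sup>2 * (1 - \<sigma>))" using \<sigma>0 \<sigma>1 by simp
  also have "\<dots> = \<sigma> * (Q * (1 - \<sigma> * Q)) + \<sigma> * (P * (1 - \<sigma> * P)) - 4 * P * Q * \<sigma> + 2 * P * Q * \<sigma>\<^sup>2"
  proof -
    have Q: "Q = 1 - P" using PQ by simp
    show ?thesis unfolding Q by (simp add: power2_eq_square algebra_simps)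
  qed
  also have "\<dots> \<le> \<alpha> * (Q * (1 - \<sigma> * Q)) + \<beta> * (P * (1 - \<sigma> * P)) - 4 * P * Q * \<sigma> + 2 * P * Q * \<sigma>\<^sup>2"
    using \<sigma>\<alpha> \<sigma>\<beta> s PQ by (intro add_right_mono diff_right_mono add_mono mult_right_mono) auto
  finally have key: "\<sigma> * (Q\<^sup>2 * \<alpha> + P\<^sup>2 * \<beta> - 2 * P * Q * \<sigma>) \<le> Q * \<alpha> + P * \<beta> - 4 * P * Q * \<sigma>"
    by (simp add: power2_eq_square algebra_simps)
  have "r * \<eta>\<^sup>2 = e\<^sup>2 * \<sigma> * (P * Q * \<eta>\<^sup>2)" by (simp add: eqs)
  also have "\<dots> \<le> e\<^sup>2 * \<sigma> * (t\<^sup>2 * (a * Q + b * P - 2 * r))"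
    using gap \<sigma>0 by (intro mult_left_mono) auto
  also have "\<dots> = t\<^sup>2 * e\<^sup>2 * e\<^sup>2 * (\<sigma> * (Q\<^sup>2 * \<alpha> + P\<^sup>2 * \<beta> - 2 * P * Q * \<sigma>))"
    unfolding eqs by (simp add: power2_eq_square algebra_simps)
  also have "\<dots> \<le> t\<^sup>2 * e\<^sup>2 * e\<^sup>2 * (Q * \<alpha> + P * \<beta> - 4 * P * Q * \<sigma>)"
    by (intro mult_left_mono key) auto
  also have "\<dots> = t\<^sup>2 * e\<^sup>2 * (a + b) - 4 * t\<^sup>2 * e\<^sup>2 * r"
    unfolding eqs by (simp add: algebra_simps)
  finally show ?thesis by (simp add: algebra_simps)
qed

text \<open>\<open>eq1\<close> and \<open>eq2\<close> are the two block rows of the eigenvalue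
  equation of A(t) for the eigenvalue \<open>l\<close>. Through them every moment in the gap
  inequality becomes a polynomial in \<open>l\<close>, \<open>t\<close>, the four squared norms and
  the coupling \<open>s\<close>.\<close>

lemma coupling_bound:
  fixes l t :: real
  assumes H1: "H1 \<in> carrier_mat m m" "mat_adjoint H1 = H1" and x: "x \<in> carrier_vec m"
    and H2: "H2 \<in> carrier_mat n n" "mat_adjoint H2 = H2" and y: "y \<in> carrier_vec n"
    and E: "E \<in> carrier_mat n m" and m: "m > 0"
    and gap: "\<And>\<mu> \<nu>. \<mu> \<in># eig H1 \<Longrightarrow> \<nu> \<in># eig H2 \<Longrightarrow> \<eta> \<le> cmod (\<mu> - \<nu>)" and \<eta>: "0 \<le> \<eta>"
    and eq1: "H1 *\<^sub>v x = of_real l \<cdot>\<^sub>v x - of_real t \<cdot>\<^sub>v (mat_adjoint E *\<^sub>v y)"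
    and eq2: "H2 *\<^sub>v y = of_real l \<cdot>\<^sub>v y - of_real t \<cdot>\<^sub>v (E *\<^sub>v x)"
    and unit: "(vec_norm2 x)\<^sup>2 + (vec_norm2 y)\<^sup>2 = 1"
  shows "(Re ((E *\<^sub>v x) \<bullet>c y))\<^sup>2 * (\<eta>\<^sup>2 + 4 * t\<^sup>2 * (spectral_norm E)\<^sup>2) \<le>
    t\<^sup>2 * (spectral_norm E)\<^sup>2 * ((vec_norm2 (mat_adjoint E *\<^sub>v y))\<^sup>2 + (vec_norm2 (E *\<^sub>v x))\<^sup>2)"
proof -
  define P Q a b s where "P = (vec_norm2 x)\<^sup>2" and "Q = (vec_norm2 y)\<^sup>2"
    and "a = (vec_norm2 (mat_adjoint E *\<^sub>v y))\<^sup>2" and "b = (vec_norm2 (E *\<^sub>v x))\<^sup>2"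
    and "s = Re ((E *\<^sub>v x) \<bullet>c y)"
  note defs = this
  have Ex: "E *\<^sub>v x \<in> carrier_vec n" and Ey: "mat_adjoint E *\<^sub>v y \<in> carrier_vec m"
    using E x mult_mat_vec_carrier[OF mat_adjoint_carrier[OF E] y] by auto
  have s': "s = Re (x \<bullet>c (mat_adjoint E *\<^sub>v y))"
    using mat_adjoint_inner[OF E x y] by (simp add: s_def)
  have n1: "(vec_norm2 (H1 *\<^sub>v x))\<^sup>2 = l\<^sup>2 * P + t\<^sup>2 * a - 2 * l * t * s"
    unfolding eq1 vec_norm2_diff_square[OF x Ey] s' P_def a_def ..
  have n2: "(vec_norm2 (H2 *\<^sub>v y))\<^sup>2 = l\<^sup>2 * Q + t\<^sup>2 * b - 2 * l * t * s"
    unfolding eq2 vec_norm2_diff_square[OF y Ex] Re_inner_commute[OF y Ex] s_def Q_def b_def ..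
  have i1: "Re ((H1 *\<^sub>v x) \<bullet>c x) = l * P - t * s"
    unfolding eq1 Re_inner_diff[OF x Ey x] Re_inner_self s' P_def
    by (simp add: Re_inner_commute[OF x Ey])
  have i2: "Re ((H2 *\<^sub>v y) \<bullet>c y) = l * Q - t * s"
    unfolding eq2 Re_inner_diff[OF y Ex y] Re_inner_self s_def Q_def ..
  have "P * Q * \<eta>\<^sup>2 \<le> (l\<^sup>2 * P + t\<^sup>2 * a - 2 * l * t * s) * Q + P * (l\<^sup>2 * Q + t\<^sup>2 * b - 2 * l * t * s)
      - 2 * (l * P - t * s) * (l * Q - t * s)"
    using spectral_gap_ineq[OF H1 x H2 y gap \<eta>]
    by (simp add: n1 n2 i1 i2 P_def[symmetric] Q_def[symmetric] mult_ac)
  \<comment> \<open>All terms containing \<open>l\<close> cancel: the gap sees only differences of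
    eigenvalues, so a common shift of both spectra has no effect.\<close>
  also have "\<dots> = t\<^sup>2 * (a * Q + b * P - 2 * s\<^sup>2)"
    by (simp add: power2_eq_square algebra_simps)
  finally have gap': "P * Q * \<eta>\<^sup>2 \<le> t\<^sup>2 * (a * Q + b * P - 2 * s\<^sup>2)" .
  have cs: "(Re (u \<bullet>c z))\<^sup>2 \<le> (vec_norm2 u)\<^sup>2 * (vec_norm2 z)\<^sup>2"
    if "u \<in> carrier_vec k" "z \<in> carrier_vec k" for u z :: "complex vec" and k
  proof -
    have "\<bar>Re (u \<bullet>c z)\<bar> \<le> vec_norm2 u * vec_norm2 z"
      by (rule order_trans[OF abs_Re_le_cmod Cauchy_Schwarz_complex_vec[OF that]])
    then have "\<bar>Re (u \<bullet>c z)\<bar>\<^sup>2 \<le> (vec_norm2 u * vec_norm2 z)\<^sup>2" by (intro power_mono) auto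
    then show ?thesis by (simp add: power_mult_distrib)
  qed
  have "s\<^sup>2 \<le> P * a" unfolding s' P_def a_def by (rule cs[OF x Ey])
  moreover have "s\<^sup>2 \<le> Q * b" using cs[OF Ex y] by (simp add: s_def Q_def b_def mult.commute)
  moreover have "a \<le> (spectral_norm E)\<^sup>2 * Q"
    unfolding a_def Q_def power_mult_distrib[symmetric]
    by (rule power_mono[OF vec_norm2_adjoint_mult_le_spectral_norm[OF E m y]]) simp
  moreover have "b \<le> (spectral_norm E)\<^sup>2 * P"
    unfolding b_def P_def power_mult_distrib[symmetric]
    by (rule power_mono[OF vec_norm2_mult_le_spectral_norm[OF E x]]) simp
  ultimately have "s\<^sup>2 * (\<eta>\<^sup>2 + 4 * t\<^sup>2 * (spectral_norm E)\<^sup>2) \<le> t\<^sup>2 * (spectral_norm E)\<^sup>2 * (a + b)"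
    using unit by (intro rotation_angle_bound[OF _ _ _ gap']) (auto simp: defs)
  then show ?thesis by (simp add: defs)
qed

section \<open>Derivatives of sorted eigenvalues\<close>

lemma mult_index_sum:
  assumes "A \<in> carrier_mat n m" "B \<in> carrier_mat m k" "i < n" "j < k"
  shows "(A * B) $$ (i,j) = (\<Sum>l<m. A $$ (i,l) * B $$ (l,j))"
  using assms by (simp add: scalar_prod_def atLeast0LessThan)

text \<open>The carrier conditions are part of the predicate so that limits of products and adjoints
  can be chained without separate side conditions on dimensions.\<close>

definition mat_tendsto :: "nat \<Rightarrow> (nat \<Rightarrow> complex mat) \<Rightarrow> complex mat \<Rightarrow> bool" where
  "mat_tendsto N X Y \<longleftrightarrow> (\<forall>n. X n \<in> carrier_mat N N) \<and> Y \<in> carrier_mat N N \<and>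
     (\<forall>i<N. \<forall>j<N. (\<lambda>n. X n $$ (i,j)) \<longlonglongrightarrow> Y $$ (i,j))"

lemma mat_tendsto_entry:
  "mat_tendsto N X Y \<Longrightarrow> i < N \<Longrightarrow> j < N \<Longrightarrow> (\<lambda>n. X n $$ (i,j)) \<longlonglongrightarrow> Y $$ (i,j)"
  by (simp add: mat_tendsto_def)

lemma mat_tendsto_const: "Y \<in> carrier_mat N N \<Longrightarrow> mat_tendsto N (\<lambda>_. Y) Y"
  by (simp add: mat_tendsto_def)

lemma mat_tendsto_mult:
  assumes "mat_tendsto N X A" "mat_tendsto N Y B"
  shows "mat_tendsto N (\<lambda>n. X n * Y n) (A * B)"
  unfolding mat_tendsto_def
proof (intro conjI allI impI)
  fix i j assume ij: "i < N" "j < N"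
  have "(\<lambda>n. \<Sum>k<N. X n $$ (i,k) * Y n $$ (k,j)) \<longlonglongrightarrow> (\<Sum>k<N. A $$ (i,k) * B $$ (k,j))"
    using assms ij unfolding mat_tendsto_def by (intro tendsto_sum tendsto_mult) auto
  moreover have "(X n * Y n) $$ (i,j) = (\<Sum>k<N. X n $$ (i,k) * Y n $$ (k,j))" for n
    using assms ij unfolding mat_tendsto_def by (intro mult_index_sum) auto
  moreover have "(A * B) $$ (i,j) = (\<Sum>k<N. A $$ (i,k) * B $$ (k,j))"
    using assms ij unfolding mat_tendsto_def by (intro mult_index_sum) auto
  ultimately show "(\<lambda>n. (X n * Y n) $$ (i,j)) \<longlonglongrightarrow> (A * B) $$ (i,j)" by simp
qed (use assms in \<open>auto simp: mat_tendsto_def\<close>)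

lemma mat_tendsto_adjoint:
  assumes "mat_tendsto N X A"
  shows "mat_tendsto N (\<lambda>n. mat_adjoint (X n)) (mat_adjoint A)"
  unfolding mat_tendsto_def
proof (intro conjI allI impI)
  fix i j assume ij: "i < N" "j < N"
  have dims: "A \<in> carrier_mat N N" "X n \<in> carrier_mat N N" for n
    using assms by (auto simp: mat_tendsto_def)
  have "mat_adjoint (X n) $$ (i,j) = cnj (X n $$ (j,i))" for n using ij dims(2)[of n] by simp
  moreover have "(\<lambda>n. cnj (X n $$ (j,i))) \<longlonglongrightarrow> cnj (A $$ (j,i))"
    using assms ij by (intro tendsto_cnj) (auto simp: mat_tendsto_def)
  ultimately show "(\<lambda>n. mat_adjoint (X n) $$ (i,j)) \<longlonglongrightarrow> mat_adjoint A $$ (i,j)"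
    using ij dims(1) by simp
qed (use assms in \<open>auto simp: mat_tendsto_def\<close>)

lemma mat_tendsto_unique:
  assumes "mat_tendsto N X A" "mat_tendsto N X B"
  shows "A = B"
proof (rule eq_matI)
  fix i j assume "i < dim_row B" "j < dim_col B"
  then have "(\<lambda>n. X n $$ (i,j)) \<longlonglongrightarrow> A $$ (i,j)" "(\<lambda>n. X n $$ (i,j)) \<longlonglongrightarrow> B $$ (i,j)"
    using assms by (auto simp: mat_tendsto_def)
  then show "A $$ (i,j) = B $$ (i,j)" by (rule LIMSEQ_unique)
qed (use assms in \<open>auto simp: mat_tendsto_def\<close>)

text \<open>Bolzano-Weierstrass for one index at a time: each refinement of the subsequence keeps
  the limits already obtained.\<close>

lemma bounded_family_convergent_subseq:
  fixes f :: "nat \<Rightarrow> 'i \<Rightarrow> complex"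
  assumes "finite S" "\<And>s n. s \<in> S \<Longrightarrow> cmod (f n s) \<le> c"
  shows "\<exists>l r. strict_mono (r :: nat \<Rightarrow> nat) \<and> (\<forall>s\<in>S. (\<lambda>n. f (r n) s) \<longlonglongrightarrow> l s)"
  using assms
proof (induction S)
  case empty
  show ?case using strict_mono_id by (auto simp: id_def)
next
  case (insert s S)
  then obtain l r where r: "strict_mono (r :: nat \<Rightarrow> nat)" "\<forall>s\<in>S. (\<lambda>n. f (r n) s) \<longlonglongrightarrow> l s"
    by auto
  have "\<forall>n. cmod (f (r n) s) \<le> c" using insert.prems by simp
  then obtain q z where q: "strict_mono (q :: nat \<Rightarrow> nat)"
    and z: "\<forall>e>0. \<exists>N. \<forall>n\<ge>N. cmod (f (r (q n)) s - z) < e"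
    using Bolzano_Weierstrass_complex_disc[of "\<lambda>n. f (r n) s" c] by blast
  have "(\<lambda>n. f (r (q n)) s) \<longlonglongrightarrow> z" using z by (simp add: LIMSEQ_iff)
  moreover have "(\<lambda>n. f (r (q n)) u) \<longlonglongrightarrow> l u" if "u \<in> S" for u
    using LIMSEQ_subseq_LIMSEQ[OF r(2)[rule_format, OF that] q] by (simp add: o_def)
  ultimately have "\<forall>u\<in>insert s S. (\<lambda>n. f ((r \<circ> q) n) u) \<longlonglongrightarrow> (l(s := z)) u"
    using insert.hyps(2) by auto
  then show ?case using strict_mono_o[OF r(1) q] by blast
qed

lemma unitary_mat_entry_le_1:
  assumes "unitary_mat N U" "i < N" "j < N"
  shows "cmod (U $$ (i,j)) \<le> 1"
proof -
  note U = unitary_matD[OF assms(1)]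
  have "of_real (\<Sum>k<N. (cmod (U $$ (k,j)))\<^sup>2) = (mat_adjoint U * U) $$ (j,j)"
    using U(1) assms(3)
    by (simp add: scalar_prod_def atLeast0LessThan complex_norm_square mult.commute del: of_real_power)
  also have "\<dots> = of_real 1" unfolding U(3) using assms(3) by simp
  finally have "(\<Sum>k<N. (cmod (U $$ (k,j)))\<^sup>2) = 1" by (simp only: of_real_eq_iff)
  then have "(cmod (U $$ (i,j)))\<^sup>2 \<le> 1"
    using member_le_sum[of i "{..<N}" "\<lambda>k. (cmod (U $$ (k,j)))\<^sup>2"] assms(2) by simp
  then show ?thesis by (simp add: abs_square_le_1)
qed

text \<open>Entries of unitary matrices have modulus at most 1, so a subsequence converges
  entrywise. The limit is unitary because the defining equation is preserved by limits of products
  and adjoints.\<close>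

lemma unitary_sequentially_compact:
  assumes "\<And>n. unitary_mat N (X n)"
  obtains U r where "unitary_mat N U" "strict_mono (r :: nat \<Rightarrow> nat)" "mat_tendsto N (\<lambda>n. X (r n)) U"
proof -
  obtain l r where r: "strict_mono (r :: nat \<Rightarrow> nat)"
    and l: "\<forall>p\<in>{..<N} \<times> {..<N}. (\<lambda>n. X (r n) $$ p) \<longlonglongrightarrow> l p"
    using bounded_family_convergent_subseq[of "{..<N} \<times> {..<N}" "\<lambda>n p. X n $$ p" 1]
      unitary_mat_entry_le_1[OF assms] by auto
  define U where "U = mat N N l"
  have lim: "mat_tendsto N (\<lambda>n. X (r n)) U"
    using l unitary_matD(1)[OF assms] by (auto simp: mat_tendsto_def U_def)
  have "mat_tendsto N (\<lambda>n. mat_adjoint (X (r n)) * X (r n)) (mat_adjoint U * U)"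
    by (intro mat_tendsto_mult mat_tendsto_adjoint lim)
  then have "mat_tendsto N (\<lambda>n. 1\<^sub>m N) (mat_adjoint U * U)"
    by (simp add: unitary_matD(3)[OF assms])
  then have "mat_adjoint U * U = 1\<^sub>m N"
    by (rule mat_tendsto_unique) (simp add: mat_tendsto_const)
  then have "unitary_mat N U" by (intro unitary_matI) (simp_all add: U_def)
  then show ?thesis using that r lim by blast
qed

text \<open>At a degenerate eigenvalue the eigenvectors along the sequence select a basis of the
  eigenspace, and it is this basis \<open>U\<close> that gives the derivatives of the sorted eigenvalues.\<close>

lemma eigenvalue_derivative_subseq:
  fixes s :: "nat \<Rightarrow> real"
  assumes A: "A \<in> carrier_mat N N" "mat_adjoint A = A"
    and V: "V \<in> carrier_mat N N" "mat_adjoint V = V"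
    and s: "s \<longlonglongrightarrow> 0" "\<And>n. s n \<noteq> 0"
  obtains U r where "unitary_mat N U" "strict_mono (r :: nat \<Rightarrow> nat)"
    "mat_adjoint U * A * U = diag_of_vec (eig_vec A)"
    "\<And>i. i < N \<Longrightarrow> (\<lambda>n. (eig_vec (A + of_real (s (r n)) \<cdot>\<^sub>m V) $ i - eig_vec A $ i) / s (r n))
       \<longlonglongrightarrow> Re ((mat_adjoint U * V * U) $$ (i,i))"
proof -
  define B where "B n = A + of_real (s n) \<cdot>\<^sub>m V" for n
  have Bc: "B n \<in> carrier_mat N N" for n using A V by (simp add: B_def)
  have Bh: "mat_adjoint (B n) = B n" for n
    unfolding B_def by (rule mat_adjoint_add_smult[OF A V])
  have "\<exists>U. unitary_mat N U \<and> mat_adjoint U * B n * U = diag_of_vec (eig_vec (B n)) \<and>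
      dim_vec (eig_vec (B n)) = N \<and>
      (\<forall>i j. i \<le> j \<longrightarrow> j < N \<longrightarrow> eig_vec (B n) $ j \<le> eig_vec (B n) $ i)" for n
    using hermitian_eig_vec[OF Bc Bh, of n] by metis
  then obtain X where X: "\<And>n. unitary_mat N (X n)"
    "\<And>n. mat_adjoint (X n) * B n * X n = diag_of_vec (eig_vec (B n))"
    and dim: "\<And>n. dim_vec (eig_vec (B n)) = N"
    and dec: "\<And>n i j. i \<le> j \<Longrightarrow> j < N \<Longrightarrow> eig_vec (B n) $ j \<le> eig_vec (B n) $ i"
    by metis
  obtain U r where U: "unitary_mat N U" and r: "strict_mono (r :: nat \<Rightarrow> nat)"
    and XU: "mat_tendsto N (\<lambda>n. X (r n)) U"
    by (rule unitary_sequentially_compact[of N X, OF X(1)])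
  note Uc = unitary_matD[OF U] and Xc = unitary_matD[OF X(1)]
  define d where "d n i = eig_vec (B n) $ i" for n i
  have D: "diag_of_vec (eig_vec (B n)) = mat_diag N (\<lambda>i. of_real (d n i))" for n
    by (simp add: diag_of_vec_def d_def dim)
  have sr: "(\<lambda>n. s (r n)) \<longlonglongrightarrow> 0"
    using LIMSEQ_subseq_LIMSEQ[OF s(1) r] by (simp add: o_def)
  have BA: "mat_tendsto N (\<lambda>n. B (r n)) A"
    unfolding mat_tendsto_def
  proof (intro conjI allI impI)
    fix i j assume ij: "i < N" "j < N"
    have "(\<lambda>n. A $$ (i,j) + of_real (s (r n)) * V $$ (i,j)) \<longlonglongrightarrow> A $$ (i,j) + of_real 0 * V $$ (i,j)"
      by (intro tendsto_intros sr)
    then show "(\<lambda>n. B (r n) $$ (i,j)) \<longlonglongrightarrow> A $$ (i,j)"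
      using A V ij by (simp add: B_def)
  qed (use A Bc in auto)
  define M where "M = mat_adjoint U * A * U"
  have lim: "mat_tendsto N (\<lambda>n. mat_diag N (\<lambda>i. of_real (d (r n) i))) M"
    using mat_tendsto_mult[OF mat_tendsto_mult[OF mat_tendsto_adjoint[OF XU] BA] XU]
    by (simp add: X(2) D M_def)
  have Mii: "(\<lambda>n. d (r n) i) \<longlonglongrightarrow> Re (M $$ (i,i))" if "i < N" for i
  proof -
    have "(\<lambda>n. mat_diag N (\<lambda>i. complex_of_real (d (r n) i)) $$ (i,i)) \<longlonglongrightarrow> M $$ (i,i)"
      using lim that by (simp add: mat_tendsto_def)
    then have "(\<lambda>n. complex_of_real (d (r n) i)) \<longlonglongrightarrow> M $$ (i,i)"
      using that by (simp add: mat_diag_def)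
    from tendsto_Re[OF this] show ?thesis by simp
  qed
  \<comment> \<open>Along the sequence the matrices are diagonal with real entries, and both
    properties survive in the limit.\<close>
  have Mdiag: "M = mat_diag N (\<lambda>i. of_real (Re (M $$ (i,i))))"
  proof (rule mat_tendsto_unique[OF lim], unfold mat_tendsto_def, intro conjI allI impI)
    fix i j assume ij: "i < N" "j < N"
    show "(\<lambda>n. mat_diag N (\<lambda>i. complex_of_real (d (r n) i)) $$ (i,j))
        \<longlonglongrightarrow> mat_diag N (\<lambda>i. of_real (Re (M $$ (i,i)))) $$ (i,j)"
      using ij by (auto simp: mat_diag_def intro!: tendsto_of_real Mii)
  qed auto
  \<comment> \<open>The decreasing order also survives in the limit, so the limiting diagonal is the
    sorted spectrum of \<open>A\<close> with matching indices.\<close>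
  have evA: "eig_vec A = vec N (\<lambda>i. Re (M $$ (i,i)))"
  proof (rule eig_vec_unique[OF A(1) U])
    show "mat_adjoint U * A * U = mat_diag N (\<lambda>i. complex_of_real (Re (M $$ (i,i))))"
      using Mdiag by (simp add: M_def)
    show "Re (M $$ (j,j)) \<le> Re (M $$ (i,i))" if "i \<le> j" "j < N" for i j
      using that dec[of i j]
      by (intro LIMSEQ_le[OF Mii Mii]) (auto simp: d_def)
  qed
  have DA: "mat_adjoint U * A * U = diag_of_vec (eig_vec A)"
  proof -
    have "diag_of_vec (eig_vec A) = mat_diag N (\<lambda>i. of_real (Re (M $$ (i,i))))"
      unfolding evA diag_of_vec_def dim_vec by (rule mat_diag_cong) simp
    then show ?thesis using Mdiag unfolding M_def by simp
  qed
  \<comment> \<open>The product of the adjoint of \<open>U\<close>, \<open>B n\<close> and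
    \<open>X n\<close> is evaluated twice: \<open>X n\<close> diagonalizes \<open>B n\<close> from
    the right, and \<open>U\<close> diagonalizes \<open>A\<close> from the left. Comparing diagonal
    entries gives an exact formula for the eigenvalue increment, without any differentiation of
    eigenvectors.\<close>
  have key: "of_real (d n i - eig_vec A $ i) * (mat_adjoint U * X n) $$ (i,i) =
      of_real (s n) * (mat_adjoint U * V * X n) $$ (i,i)" if i: "i < N" for n i
  proof -
    have "X n * (mat_adjoint (X n) * B n * X n) = (X n * mat_adjoint (X n)) * (B n * X n)"
      using Xc(1,2) Bc by (simp add: assoc_mult_mat[of _ N N _ N _ N])
    also have "\<dots> = B n * X n" unfolding Xc(4) using Xc(1)[of n] Bc[of n] by simp
    finally have BX: "B n * X n = X n * mat_diag N (\<lambda>i. of_real (d n i))"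
      unfolding X(2) D by simp
    have "mat_adjoint U * A * U * mat_adjoint U = mat_adjoint U * A * (U * mat_adjoint U)"
      using Uc(1,2) A(1) by (simp add: assoc_mult_mat[of _ N N _ N _ N])
    also have "\<dots> = mat_adjoint U * A" unfolding Uc(4) using Uc(2) A(1) by simp
    finally have UA: "mat_adjoint U * A = mat_diag N (\<lambda>i. of_real (Re (M $$ (i,i)))) * mat_adjoint U"
      using Mdiag by (simp add: M_def)
    have "of_real (d n i) * (mat_adjoint U * X n) $$ (i,i) =
        (mat_adjoint U * X n * mat_diag N (\<lambda>i. of_real (d n i))) $$ (i,i)"
      using i Uc Xc[of n] by (subst mat_diag_mult_right[of _ N]) auto
    also have "mat_adjoint U * X n * mat_diag N (\<lambda>i. of_real (d n i)) = mat_adjoint U * (B n * X n)"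
      unfolding BX using Uc Xc[of n] by (simp add: assoc_mult_mat[of _ N N _ N _ N])
    also have "\<dots> = mat_adjoint U * (A * X n + of_real (s n) \<cdot>\<^sub>m (V * X n))"
      using A V Xc(1)[of n] by (simp add: B_def add_mult_distrib_mat[of _ N N] mult_smult_assoc_mat[of _ N N _ N])
    also have "\<dots> = mat_adjoint U * A * X n + of_real (s n) \<cdot>\<^sub>m (mat_adjoint U * V * X n)"
      using A(1) V(1) Xc(1)[of n] Uc(2)
      by (simp add: mult_add_distrib_mat[of _ N N _ N] mult_smult_distrib[of _ N N _ N]
          assoc_mult_mat[of _ N N _ N _ N])
    also have "\<dots> $$ (i,i) = (mat_adjoint U * A * X n) $$ (i,i) +
        of_real (s n) * (mat_adjoint U * V * X n) $$ (i,i)"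
      using i Uc Xc[of n] V A by simp
    also have "mat_adjoint U * A * X n =
        mat_diag N (\<lambda>i. of_real (Re (M $$ (i,i)))) * (mat_adjoint U * X n)"
      unfolding UA using Uc(2) Xc(1)[of n] by (simp add: assoc_mult_mat[of _ N N _ N _ N])
    also have "\<dots> $$ (i,i) = of_real (eig_vec A $ i) * (mat_adjoint U * X n) $$ (i,i)"
      using i Uc(2) Xc(1)[of n] by (subst mat_diag_mult_left[of _ N N]) (auto simp: evA)
    finally show ?thesis by (simp add: algebra_simps)
  qed
  show ?thesis
  proof (rule that[OF U r DA])
    fix i assume i: "i < N"
    have "mat_tendsto N (\<lambda>n. mat_adjoint U * X (r n)) (mat_adjoint U * U)"
      by (intro mat_tendsto_mult mat_tendsto_const XU Uc(2))
    from mat_tendsto_entry[OF this i i]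
    have c1: "(\<lambda>n. (mat_adjoint U * X (r n)) $$ (i,i)) \<longlonglongrightarrow> 1"
      unfolding Uc(3) using i by simp
    have "mat_tendsto N (\<lambda>n. mat_adjoint U * V * X (r n)) (mat_adjoint U * V * U)"
      by (intro mat_tendsto_mult mat_tendsto_const XU Uc(2) V(1))
    note c2 = mat_tendsto_entry[OF this i i]
    have "(\<lambda>n. (mat_adjoint U * V * X (r n)) $$ (i,i) / (mat_adjoint U * X (r n)) $$ (i,i))
        \<longlonglongrightarrow> (mat_adjoint U * V * U) $$ (i,i) / 1"
      by (intro tendsto_divide c1 c2) simp
    \<comment> \<open>The denominators tend to 1, so \<open>key\<close> may be divided by them for
      all large n.\<close>
    moreover have "\<forall>\<^sub>F n in sequentially. (mat_adjoint U * X (r n)) $$ (i,i) \<noteq> 0"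
      using tendsto_imp_eventually_ne[OF c1] by simp
    then have "\<forall>\<^sub>F n in sequentially.
        (mat_adjoint U * V * X (r n)) $$ (i,i) / (mat_adjoint U * X (r n)) $$ (i,i) =
        of_real ((d (r n) i - eig_vec A $ i) / s (r n))"
    proof eventually_elim
      case (elim n)
      then show ?case using key[OF i, of "r n"] s(2)[of "r n"] by (simp add: field_simps)
    qed
    ultimately have "(\<lambda>n. complex_of_real ((d (r n) i - eig_vec A $ i) / s (r n)))
        \<longlonglongrightarrow> (mat_adjoint U * V * U) $$ (i,i)"
      by (simp add: tendsto_cong)
    from tendsto_Re[OF this]
    show "(\<lambda>n. (eig_vec (A + of_real (s (r n)) \<cdot>\<^sub>m V) $ i - eig_vec A $ i) / s (r n))
        \<longlonglongrightarrow> Re ((mat_adjoint U * V * U) $$ (i,i))"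
      by (simp add: d_def B_def)
  qed
qed

section \<open>Integration along the path\<close>

lemma adjoint_conj_diag_entry:
  fixes M U :: "complex mat"
  assumes "M \<in> carrier_mat n n" "U \<in> carrier_mat n n" "i < n"
  shows "(mat_adjoint U * M * U) $$ (i,i) = (M *\<^sub>v col U i) \<bullet>c col U i"
proof -
  have "mat_adjoint U * M * U = mat_adjoint U * (M * U)"
    using assms by (simp add: assoc_mult_mat[of _ n n _ n _ n])
  then have "(mat_adjoint U * M * U) $$ (i,i) = row (mat_adjoint U) i \<bullet> (M *\<^sub>v col U i)"
    using assms by (simp flip: col_mult2[of _ n n _ n])
  also have "row (mat_adjoint U) i = conjugate (col U i)"
    using assms by (intro eq_vecI) auto
  also have "conjugate (col U i) \<bullet> (M *\<^sub>v col U i) = (M *\<^sub>v col U i) \<bullet>c col U i"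
    using assms mult_mat_vec_carrier[OF assms(1), of "col U i"] by (intro comm_scalar_prod[of _ n]) auto
  finally show ?thesis .
qed

lemma vec_norm2_col_unitary:
  assumes U: "unitary_mat n U" and i: "i < n"
  shows "vec_norm2 (col U i) = 1"
proof -
  note Uc = unitary_matD[OF U]
  have u: "col U i \<in> carrier_vec n" using Uc i by simp
  have "col U i \<bullet>c col U i = (mat_adjoint U * 1\<^sub>m n * U) $$ (i,i)"
    unfolding adjoint_conj_diag_entry[OF one_carrier_mat Uc(1) i] using u by simp
  then have "col U i \<bullet>c col U i = (mat_adjoint U * U) $$ (i,i)"
    unfolding right_mult_one_mat[OF Uc(2)] .
  then have "col U i \<bullet>c col U i = 1" unfolding Uc(3) using i by simp
  then have "(vec_norm2 (col U i))\<^sup>2 = 1" by (simp flip: Re_inner_self)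
  then have "\<bar>vec_norm2 (col U i)\<bar> = 1" by (simp only: abs_square_eq_1)
  then show ?thesis by simp
qed

text \<open>The one place where a Q-norm gives more than unitary invariance. The numbers
  \<open>d i\<close> are compared with the column norms of \<open>V * U\<close>, which are not
  diagonal entries of anything at hand, but their squares are. Passing to \<open>\<nu>'\<close>
  squares the quantities; monotonicity on diagonals, pinching and unitary invariance then apply, and
  the square root returns to \<open>\<nu>\<close>.\<close>

lemma Q_norm_diag_le:
  assumes Q: "Q_norm N \<nu>" and V: "V \<in> carrier_mat N N" and U: "unitary_mat N U" and c: "0 \<le> c"
    and d: "\<And>i. i < N \<Longrightarrow> (d i)\<^sup>2 \<le> c\<^sup>2 * (vec_norm2 (V *\<^sub>v col U i))\<^sup>2"
  shows "\<nu> (mat_diag N (\<lambda>i. complex_of_real (d i))) \<le> c * \<nu> V"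
proof -
  obtain \<nu>' where inv: "unitarily_invariant_norm N \<nu>'"
    and \<nu>: "\<And>Y. Y \<in> carrier_mat N N \<Longrightarrow> \<nu> Y = sqrt (\<nu>' (mat_adjoint Y * Y))"
    using Q by (auto simp: Q_norm_def)
  note \<nu>' = unitarily_invariant_normD[OF inv] and Uc = unitary_matD[OF U]
  define W where "W = mat_adjoint V * V"
  define M where "M = mat_adjoint U * W * U"
  have Wc: "W \<in> carrier_mat N N" using V by (simp add: W_def)
  have Mc: "M \<in> carrier_mat N N" using Wc Uc by (simp add: M_def)
  have Mii: "M $$ (i,i) = of_real ((vec_norm2 (V *\<^sub>v col U i))\<^sup>2)" if i: "i < N" for i
  proof -
    have u: "col U i \<in> carrier_vec N" using i Uc by simp
    then have Vu: "V *\<^sub>v col U i \<in> carrier_vec N" using V by simp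
    have "M $$ (i,i) = (W *\<^sub>v col U i) \<bullet>c col U i"
      unfolding M_def by (rule adjoint_conj_diag_entry[OF Wc Uc(1) i])
    also have "W *\<^sub>v col U i = mat_adjoint V *\<^sub>v (V *\<^sub>v col U i)"
      unfolding W_def by (rule assoc_mult_mat_vec[OF mat_adjoint_carrier[OF V] V u])
    also have "\<dots> \<bullet>c col U i = (V *\<^sub>v col U i) \<bullet>c (V *\<^sub>v col U i)"
      using mat_adjoint_inner[OF mat_adjoint_carrier[OF V] Vu u] by simp
    finally show ?thesis by (simp only: vec_norm2_inner)
  qed
  let ?D = "mat_diag N (\<lambda>i. complex_of_real (d i))"
  have "mat_adjoint ?D * ?D = mat_diag N (\<lambda>i. complex_of_real ((d i)\<^sup>2))"
    by (simp add: power2_eq_square)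
  then have "\<nu>' (mat_adjoint ?D * ?D) = \<nu>' (mat_diag N (\<lambda>i. complex_of_real ((d i)\<^sup>2)))"
    by (rule arg_cong)
  also have "\<dots> \<le> \<nu>' (mat_diag N (\<lambda>i. complex_of_real (c\<^sup>2 * (vec_norm2 (V *\<^sub>v col U i))\<^sup>2)))"
    by (rule norm_mat_diag_mono[OF inv]) (use d in simp)
  also have "mat_diag N (\<lambda>i. complex_of_real (c\<^sup>2 * (vec_norm2 (V *\<^sub>v col U i))\<^sup>2)) =
      of_real (c\<^sup>2) \<cdot>\<^sub>m mat_diag N (\<lambda>i. M $$ (i,i))"
    by (rule eq_matI) (auto simp: mat_diag_def Mii simp del: of_real_power of_real_mult simp flip: of_real_mult)
  also have "\<nu>' \<dots> = c\<^sup>2 * \<nu>' (mat_diag N (\<lambda>i. M $$ (i,i)))"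
    by (simp only: \<nu>'(3)[OF mat_diag_dim] norm_of_real abs_power2)
  also have "\<dots> \<le> c\<^sup>2 * \<nu>' M"
    by (intro mult_left_mono pinching[OF inv Mc]) simp
  also have "\<nu>' M = \<nu>' W"
    unfolding M_def by (rule \<nu>'(5)[OF Wc unitary_mat_adjoint[OF U] U])
  finally have "sqrt (\<nu>' (mat_adjoint ?D * ?D)) \<le> sqrt (c\<^sup>2 * \<nu>' W)" by simp
  also have "\<dots> = c * \<nu> V"
    unfolding real_sqrt_mult \<nu>[OF V] W_def using c by simp
  finally show ?thesis unfolding \<nu>[OF mat_diag_dim] .
qed

section \<open>Block vectors and the eigenvectors of the path\<close>

lemma conjugate_append_vec:
  fixes x y :: "complex vec"
  shows "conjugate (x @\<^sub>v y) = conjugate x @\<^sub>v conjugate y"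
proof (rule eq_vecI)
  fix i assume "i < dim_vec (conjugate x @\<^sub>v conjugate y)"
  then show "conjugate (x @\<^sub>v y) $ i = (conjugate x @\<^sub>v conjugate y) $ i"
    by (cases "i < dim_vec x") (simp_all add: vec_index_conjugate)
qed simp

lemma inner_append_vec:
  fixes x x' y y' :: "complex vec"
  assumes "x \<in> carrier_vec m" "x' \<in> carrier_vec m" "y \<in> carrier_vec n" "y' \<in> carrier_vec n"
  shows "(x @\<^sub>v y) \<bullet>c (x' @\<^sub>v y') = x \<bullet>c x' + y \<bullet>c y'"
  unfolding conjugate_append_vec
  by (rule scalar_prod_append[OF assms(1,3) carrier_vec_conjugate[OF assms(2)] carrier_vec_conjugate[OF assms(4)]])

lemma vec_norm2_append:
  assumes "x \<in> carrier_vec m" "y \<in> carrier_vec n"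
  shows "(vec_norm2 (x @\<^sub>v y))\<^sup>2 = (vec_norm2 x)\<^sup>2 + (vec_norm2 y)\<^sup>2"
  using arg_cong[OF inner_append_vec[OF assms(1,1) assms(2,2)], of Re]
  by (simp only: Re_inner_self plus_complex.sel)

lemma zero_mat_mult_vec:
  fixes x :: "complex vec"
  assumes "x \<in> carrier_vec m"
  shows "0\<^sub>m n m *\<^sub>v x = 0\<^sub>v n"
  using assms by (intro eq_vecI) auto

lemma smult_mat_mult_vec:
  fixes A :: "complex mat"
  assumes "A \<in> carrier_mat n m" "x \<in> carrier_vec m"
  shows "(c \<cdot>\<^sub>m A) *\<^sub>v x = c \<cdot>\<^sub>v (A *\<^sub>v x)"
  using assms by (intro eq_vecI) auto

text \<open>A column of \<open>U\<close> is a unit eigenvector; splitting it after entry m gives the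
  data of \<open>coupling_bound\<close>. Its Rayleigh quotient for \<open>V\<close> is a sum of two
  inner products with the same real part, which accounts for the factor 4 after squaring.\<close>

lemma off_diagonal_eigenbasis_bound:
  fixes t :: real
  assumes H1: "H1 \<in> carrier_mat m m" "mat_adjoint H1 = H1"
    and H2: "H2 \<in> carrier_mat n n" "mat_adjoint H2 = H2"
    and E: "E \<in> carrier_mat n m" and m: "m > 0"
    and gap: "\<And>\<mu> \<nu>. \<mu> \<in># eig H1 \<Longrightarrow> \<nu> \<in># eig H2 \<Longrightarrow> \<eta> \<le> cmod (\<mu> - \<nu>)" and \<eta>: "0 \<le> \<eta>"
    and U: "unitary_mat (m + n) U"
    and V_def: "V = four_block_mat (0\<^sub>m m m) (mat_adjoint E) E (0\<^sub>m n n)"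
    and D: "mat_adjoint U * (four_block_mat H1 (0\<^sub>m m n) (0\<^sub>m n m) H2 + of_real t \<cdot>\<^sub>m V) * U =
      mat_diag (m + n) (\<lambda>i. of_real (l i))"
    and i: "i < m + n"
  shows "(Re ((mat_adjoint U * V * U) $$ (i,i)))\<^sup>2 * (\<eta>\<^sup>2 + 4 * t\<^sup>2 * (spectral_norm E)\<^sup>2) \<le>
    4 * t\<^sup>2 * (spectral_norm E)\<^sup>2 * (vec_norm2 (V *\<^sub>v col U i))\<^sup>2"
proof -
  let ?N = "m + n"
  note Uc = unitary_matD[OF U]
  have V: "V \<in> carrier_mat ?N ?N" using E by (simp add: V_def)
  define A0 where "A0 = four_block_mat H1 (0\<^sub>m m n) (0\<^sub>m n m) H2"
  have A0: "A0 \<in> carrier_mat ?N ?N" using H1 H2 by (simp add: A0_def)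
  define A where "A = A0 + of_real t \<cdot>\<^sub>m V"
  have A: "A \<in> carrier_mat ?N ?N" using A0 V by (simp add: A_def)
  define v where "v = col U i"
  have v: "v \<in> carrier_vec ?N" using Uc i by (simp add: v_def)
  define x y where "x = vec_first v m" and "y = vec_last v n"
  have x: "x \<in> carrier_vec m" and y: "y \<in> carrier_vec n" by (simp_all add: x_def y_def)
  have vxy: "v = x @\<^sub>v y" unfolding x_def y_def by (rule vec_first_last_append[OF v, symmetric])
  have Ex: "E *\<^sub>v x \<in> carrier_vec n" and Ey: "mat_adjoint E *\<^sub>v y \<in> carrier_vec m"
    using E x mult_mat_vec_carrier[OF mat_adjoint_carrier[OF E] y] by auto
  have H1x: "H1 *\<^sub>v x \<in> carrier_vec m" and H2y: "H2 *\<^sub>v y \<in> carrier_vec n" using H1 H2 x y by auto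
  have Vv: "V *\<^sub>v v = (mat_adjoint E *\<^sub>v y) @\<^sub>v (E *\<^sub>v x)"
    unfolding V_def vxy
    by (subst four_block_mat_mult_vec[OF zero_carrier_mat mat_adjoint_carrier[OF E] E zero_carrier_mat x y])
      (use x y Ex Ey in \<open>simp add: zero_mat_mult_vec\<close>)
  have A0v: "A0 *\<^sub>v v = (H1 *\<^sub>v x) @\<^sub>v (H2 *\<^sub>v y)"
    unfolding A0_def vxy
    by (subst four_block_mat_mult_vec[OF H1(1) zero_carrier_mat zero_carrier_mat H2(1) x y])
      (use x y H1x H2y in \<open>simp add: zero_mat_mult_vec\<close>)
  have "A * U = U * (mat_adjoint U * A * U)"
  proof -
    have "U * (mat_adjoint U * A * U) = (U * mat_adjoint U) * (A * U)"
      using Uc(1,2) A by (simp add: assoc_mult_mat[of _ ?N ?N _ ?N _ ?N])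
    then show ?thesis unfolding Uc(4) using Uc(1) A by simp
  qed
  then have AU: "A * U = U * mat_diag ?N (\<lambda>i. of_real (l i))"
    using D unfolding A_def A0_def by simp
  have "A *\<^sub>v v = col (A * U) i" unfolding v_def by (rule col_mult2[OF A Uc(1) i, symmetric])
  also have "\<dots> = of_real (l i) \<cdot>\<^sub>v v"
    unfolding AU using Uc(1) i
    by (subst mat_diag_mult_right[of _ ?N]) (auto intro!: eq_vecI simp: v_def)
  finally have Av: "A *\<^sub>v v = of_real (l i) \<cdot>\<^sub>v v" .
  have "A *\<^sub>v v = A0 *\<^sub>v v + of_real t \<cdot>\<^sub>v (V *\<^sub>v v)"
    unfolding A_def using A0 V v by (simp add: add_mult_distrib_mat_vec[of _ ?N ?N] smult_mat_mult_vec[OF V v])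
  then have eq: "((H1 *\<^sub>v x) @\<^sub>v (H2 *\<^sub>v y)) + of_real t \<cdot>\<^sub>v ((mat_adjoint E *\<^sub>v y) @\<^sub>v (E *\<^sub>v x)) =
      of_real (l i) \<cdot>\<^sub>v (x @\<^sub>v y)"
    unfolding Av A0v Vv by (simp add: vxy)
  note dims = carrier_vecD[OF x] carrier_vecD[OF y] carrier_vecD[OF H1x] carrier_vecD[OF H2y]
    carrier_vecD[OF Ex] carrier_vecD[OF Ey]
  have eq1: "H1 *\<^sub>v x = of_real (l i) \<cdot>\<^sub>v x - of_real t \<cdot>\<^sub>v (mat_adjoint E *\<^sub>v y)"
  proof (rule eq_vecI)
    fix k assume "k < dim_vec (of_real (l i) \<cdot>\<^sub>v x - of_real t \<cdot>\<^sub>v (mat_adjoint E *\<^sub>v y))"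
    then have k: "k < m" using dims by simp
    then show "(H1 *\<^sub>v x) $ k = (of_real (l i) \<cdot>\<^sub>v x - of_real t \<cdot>\<^sub>v (mat_adjoint E *\<^sub>v y)) $ k"
      using arg_cong[OF eq, of "\<lambda>w. w $ k"] dims
      by (simp del: index_mult_mat_vec dim_mult_mat_vec add: algebra_simps)
  qed (use dims in \<open>simp del: dim_mult_mat_vec\<close>)
  have eq2: "H2 *\<^sub>v y = of_real (l i) \<cdot>\<^sub>v y - of_real t \<cdot>\<^sub>v (E *\<^sub>v x)"
  proof (rule eq_vecI)
    fix k assume "k < dim_vec (of_real (l i) \<cdot>\<^sub>v y - of_real t \<cdot>\<^sub>v (E *\<^sub>v x))"
    then have k: "k < n" using dims by simp
    then show "(H2 *\<^sub>v y) $ k = (of_real (l i) \<cdot>\<^sub>v y - of_real t \<cdot>\<^sub>v (E *\<^sub>v x)) $ k"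
      \<comment> \<open>Entries of the lower block of an appended vector start at index m.\<close>
      using arg_cong[OF eq, of "\<lambda>w. w $ (m + k)"] dims
      by (simp del: index_mult_mat_vec dim_mult_mat_vec add: algebra_simps)
  qed (use dims in \<open>simp del: dim_mult_mat_vec\<close>)
  have "vec_norm2 v = 1" unfolding v_def by (rule vec_norm2_col_unitary[OF U i])
  then have "(vec_norm2 v)\<^sup>2 = 1" by simp
  then have unit: "(vec_norm2 x)\<^sup>2 + (vec_norm2 y)\<^sup>2 = 1"
    unfolding vxy vec_norm2_append[OF x y] .
  let ?s = "Re ((E *\<^sub>v x) \<bullet>c y)"
  have "(mat_adjoint U * V * U) $$ (i,i) = (V *\<^sub>v v) \<bullet>c v"
    unfolding v_def by (rule adjoint_conj_diag_entry[OF V Uc(1) i])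
  also have "\<dots> = (mat_adjoint E *\<^sub>v y) \<bullet>c x + (E *\<^sub>v x) \<bullet>c y"
    unfolding Vv using inner_append_vec[OF Ey x Ex y] by (simp only: vxy[symmetric])
  finally have "Re ((mat_adjoint U * V * U) $$ (i,i)) = Re ((mat_adjoint E *\<^sub>v y) \<bullet>c x) + ?s"
    by simp
  also have "Re ((mat_adjoint E *\<^sub>v y) \<bullet>c x) = ?s"
    using Re_inner_commute[OF Ey x] mat_adjoint_inner[OF E x y] by simp
  finally have "Re ((mat_adjoint U * V * U) $$ (i,i)) = 2 * ?s" by simp
  moreover have "(vec_norm2 (V *\<^sub>v col U i))\<^sup>2 =
      (vec_norm2 (mat_adjoint E *\<^sub>v y))\<^sup>2 + (vec_norm2 (E *\<^sub>v x))\<^sup>2"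
    unfolding v_def[symmetric] Vv by (rule vec_norm2_append[OF Ey Ex])
  moreover have "?s\<^sup>2 * (\<eta>\<^sup>2 + 4 * t\<^sup>2 * (spectral_norm E)\<^sup>2) \<le>
      t\<^sup>2 * (spectral_norm E)\<^sup>2 * ((vec_norm2 (mat_adjoint E *\<^sub>v y))\<^sup>2 + (vec_norm2 (E *\<^sub>v x))\<^sup>2)"
    by (rule coupling_bound[OF H1 x H2 y E m gap \<eta> eq1 eq2 unit])
  moreover have "(2 * r)\<^sup>2 * K \<le> 4 * t\<^sup>2 * e * q" if "r\<^sup>2 * K \<le> t\<^sup>2 * e * q" for r K e q :: real
    using that by (simp add: power_mult_distrib)
  ultimately show ?thesis by (simp only:)
qed

text \<open>The bound with constant 1. It is what remains for \<eta> = 0, where the coupling bound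
  says nothing at t = 0 or for a vanishing spectral norm.\<close>

lemma Rayleigh_le_image_norm:
  assumes V: "V \<in> carrier_mat n n" and U: "unitary_mat n U" and i: "i < n"
  shows "(Re ((mat_adjoint U * V * U) $$ (i,i)))\<^sup>2 \<le> (vec_norm2 (V *\<^sub>v col U i))\<^sup>2"
proof -
  note Uc = unitary_matD[OF U]
  have u: "col U i \<in> carrier_vec n" using Uc i by simp
  have n1: "vec_norm2 (col U i) = 1" by (rule vec_norm2_col_unitary[OF U i])
  have "\<bar>Re ((mat_adjoint U * V * U) $$ (i,i))\<bar> \<le> cmod ((V *\<^sub>v col U i) \<bullet>c col U i)"
    unfolding adjoint_conj_diag_entry[OF V Uc(1) i] by (rule abs_Re_le_cmod)
  also have "\<dots> \<le> vec_norm2 (V *\<^sub>v col U i) * vec_norm2 (col U i)"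
    using V u by (intro Cauchy_Schwarz_complex_vec[of _ n]) auto
  finally have "\<bar>Re ((mat_adjoint U * V * U) $$ (i,i))\<bar> \<le> vec_norm2 (V *\<^sub>v col U i)" by (simp add: n1)
  then have "\<bar>Re ((mat_adjoint U * V * U) $$ (i,i))\<bar>\<^sup>2 \<le> (vec_norm2 (V *\<^sub>v col U i))\<^sup>2"
    by (intro power_mono) simp_all
  then show ?thesis by simp
qed

text \<open>A mean value inequality for a pseudometric \<open>g\<close> on the parameter line, with
  F in the role of the integral of f. The claim with an error proportional to the length of the
  interval is additive under concatenation by the triangle inequality, and it holds on short
  intervals around each point; Bolzano's bisection principle extends it to the whole interval.
  Neither differentiability of what \<open>g\<close> measures nor integrability of f enters.\<close>

lemma increment_le_integral:
  fixes g :: "real \<Rightarrow> real \<Rightarrow> real"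
  assumes ab: "a \<le> b"
    and refl: "\<And>s. g s s = 0" and sym: "\<And>s t. g s t = g t s"
    and tri: "\<And>r s t. g r t \<le> g r s + g s t"
    and deriv: "\<And>t. a \<le> t \<Longrightarrow> t \<le> b \<Longrightarrow> (F has_real_derivative f t) (at t)"
    and loc: "\<And>t \<delta>. a \<le> t \<Longrightarrow> t \<le> b \<Longrightarrow> 0 < \<delta> \<Longrightarrow> \<forall>\<^sub>F s in at t. g t s \<le> (f t + \<delta>) * \<bar>s - t\<bar>"
  shows "g a b \<le> F b - F a"
proof (rule field_le_epsilon)
  fix e :: real assume e: "0 < e"
  \<comment> \<open>Chosen so that the total error \<open>2 * \<delta> * (b - a)\<close> stays below
    \<open>e\<close>; the added 1 keeps the denominator positive when a = b.\<close>
  define \<delta> where "\<delta> = e / (2 * (b - a + 1))"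
  have \<delta>: "0 < \<delta>" using e ab by (simp add: \<delta>_def)
  have "g a b \<le> F b - F a + 2 * \<delta> * (b - a)"
    using ab
  proof (induction rule: Bolzano)
    case (trans r s t)
    then show ?case using tri[of r t s] by (simp add: algebra_simps)
  next
    case (local t)
    have "((\<lambda>s. (F s - F t) / (s - t)) \<longlongrightarrow> f t) (at t)"
      using deriv[OF local] by (simp add: has_field_derivative_iff)
    then have "\<forall>\<^sub>F s in at t. dist ((F s - F t) / (s - t)) (f t) < \<delta>"
      using \<delta> by (rule tendstoD)
    with loc[OF local \<delta>]
    have "\<forall>\<^sub>F s in at t. g t s \<le> (f t + \<delta>) * \<bar>s - t\<bar> \<and> f t < (F s - F t) / (s - t) + \<delta>"
      by eventually_elim (auto simp: dist_real_def)
    then obtain d where d: "d > 0" and near: "\<And>s. s \<noteq> t \<Longrightarrow> dist s t < d \<Longrightarrow>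
        g t s \<le> (f t + \<delta>) * \<bar>s - t\<bar> \<and> f t < (F s - F t) / (s - t) + \<delta>"
      unfolding eventually_at by blast
    \<comment> \<open>One \<delta> is the slack of the local bound, the other pays for replacing
      \<open>f t\<close> by the difference quotient of F.\<close>
    have step: "g t s \<le> \<bar>s - t\<bar> * ((F s - F t) / (s - t)) + 2 * \<delta> * \<bar>s - t\<bar>" if "dist s t < d" for s
    proof (cases "s = t")
      case False
      have "(f t + \<delta>) * \<bar>s - t\<bar> \<le> ((F s - F t) / (s - t) + 2 * \<delta>) * \<bar>s - t\<bar>"
        using near[OF False that] by (intro mult_right_mono) auto
      then show ?thesis using near[OF False that] by (simp add: algebra_simps)
    qed (simp add: refl)
    show ?case
    proof (intro exI[of _ d] conjI allI impI d)
      \<comment> \<open>The interval is split at \<open>t\<close>. The local bound always starts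
        from \<open>t\<close>, so symmetry of \<open>g\<close> is needed for the left half.\<close>
      fix u v assume uv: "u \<le> t \<and> t \<le> v \<and> v - u < d"
      have "g t u \<le> F t - F u + 2 * \<delta> * (t - u)"
      proof (cases "u = t")
        case False
        then have "\<bar>u - t\<bar> * ((F u - F t) / (u - t)) = F t - F u"
          using uv by (simp add: abs_of_neg field_split_simps)
        then show ?thesis using step[of u] uv False by (simp add: dist_real_def)
      qed (simp add: refl)
      moreover have "g t v \<le> F v - F t + 2 * \<delta> * (v - t)"
      proof (cases "v = t")
        case False
        then have "\<bar>v - t\<bar> * ((F v - F t) / (v - t)) = F v - F t"
          using uv by simp
        then show ?thesis using step[of v] uv False by (simp add: dist_real_def)
      qed (simp add: refl)
      ultimately show "g u v \<le> F v - F u + 2 * \<delta> * (v - u)"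
        using tri[of u v t] sym[of u t] by (simp add: algebra_simps)
    qed
  qed
  also have "2 * \<delta> * (b - a) \<le> e"
    using e ab by (simp add: \<delta>_def field_simps)
  finally show "g a b \<le> F b - F a + e" by simp
qed

text \<open>The cases \<eta> = 0 and \<eta> > 0 need different functions. Packaging them behind one
  interface leaves the remaining argument free of the distinction: it needs only that
  \<open>f\<close> is nonnegative, bounds the derivatives pointwise and has an antiderivative with
  the right increment.\<close>

lemma phi_antiderivative:
  fixes \<eta> \<epsilon> :: real
  assumes "0 \<le> \<eta>" "0 \<le> \<epsilon>"
  obtains F f where "\<And>t. 0 \<le> t \<Longrightarrow> (F has_real_derivative f t) (at t)"
    "\<And>t. 0 \<le> t \<Longrightarrow> 0 \<le> f t"
    "\<And>t r q. 0 \<le> t \<Longrightarrow> r\<^sup>2 \<le> q \<Longrightarrow> r\<^sup>2 * (\<eta>\<^sup>2 + 4 * t\<^sup>2 * \<epsilon>\<^sup>2) \<le> 4 * t\<^sup>2 * \<epsilon>\<^sup>2 * q \<Longrightarrow> r\<^sup>2 \<le> (f t)\<^sup>2 * q"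
    "F 1 - F 0 = phi \<eta> \<epsilon>"
proof (cases "\<eta> = 0")
  case True
  have "phi \<eta> \<epsilon> = 1" using True assms by (simp add: phi_def real_sqrt_mult)
  \<comment> \<open>For \<eta> = 0 the value of \<open>phi\<close> is 1 for every \<epsilon>, by its
    default value when \<epsilon> = 0, so the constant rate 1 from the Cauchy-Schwarz bound is
    exactly enough.\<close>
  then show ?thesis using that[of "\<lambda>t. t" "\<lambda>_. 1"] by auto
next
  case False
  then have \<eta>: "0 < \<eta>" using assms by simp
  have pos: "0 < \<eta>\<^sup>2 + 4 * t\<^sup>2 * \<epsilon>\<^sup>2" for t using \<eta> by (simp add: add_pos_nonneg)
  \<comment> \<open>For \<open>\<epsilon> = 0\<close> both functions below are constantly 0, because division by 0 gives 0.\<close>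
  let ?F = "\<lambda>t. sqrt (\<eta>\<^sup>2 + 4 * t\<^sup>2 * \<epsilon>\<^sup>2) / (2 * \<epsilon>)"
  let ?f = "\<lambda>t. 2 * t * \<epsilon> / sqrt (\<eta>\<^sup>2 + 4 * t\<^sup>2 * \<epsilon>\<^sup>2)"
  show ?thesis
  proof (rule that[of ?F ?f])
    show "(?F has_real_derivative ?f t) (at t)" for t
    proof (cases "\<epsilon> = 0")
      case False
      have "((\<lambda>t. \<eta>\<^sup>2 + 4 * t\<^sup>2 * \<epsilon>\<^sup>2) has_real_derivative 8 * t * \<epsilon>\<^sup>2) (at t)"
        by (auto intro!: derivative_eq_intros)
      from DERIV_cdivide[OF DERIV_chain2[OF DERIV_real_sqrt[OF pos[of t]] this], of "2 * \<epsilon>"]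
      have "(?F has_real_derivative inverse (sqrt (\<eta>\<^sup>2 + 4 * t\<^sup>2 * \<epsilon>\<^sup>2)) / 2 * (8 * t * \<epsilon>\<^sup>2) / (2 * \<epsilon>)) (at t)" .
      moreover have "inverse R / 2 * (8 * t * \<epsilon>\<^sup>2) / (2 * \<epsilon>) = 2 * t * \<epsilon> / R" for R
        using False by (cases "R = 0") (simp_all add: field_simps power2_eq_square)
      ultimately show ?thesis by (simp only:)
    qed simp
    show "0 \<le> ?f t" if "0 \<le> t" for t using that assms by simp
    show "r\<^sup>2 \<le> (?f t)\<^sup>2 * q" if "r\<^sup>2 * (\<eta>\<^sup>2 + 4 * t\<^sup>2 * \<epsilon>\<^sup>2) \<le> 4 * t\<^sup>2 * \<epsilon>\<^sup>2 * q" for t r q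
    proof -
      have "(?f t)\<^sup>2 * q = 4 * t\<^sup>2 * \<epsilon>\<^sup>2 * q / (\<eta>\<^sup>2 + 4 * t\<^sup>2 * \<epsilon>\<^sup>2)"
        using pos[of t] by (simp add: power_divide power_mult_distrib)
      then show ?thesis using that pos[of t] by (simp add: pos_le_divide_eq)
    qed
    show "?F 1 - ?F 0 = phi \<eta> \<epsilon>"
    proof (cases "\<epsilon> = 0")
      case True
      then show ?thesis using \<eta> by (simp add: phi_def)
    next
      case False
      define R where "R = sqrt (\<eta>\<^sup>2 + 4 * \<epsilon>\<^sup>2)"
      have R2: "R\<^sup>2 = \<eta>\<^sup>2 + 4 * \<epsilon>\<^sup>2" by (simp add: R_def)
      have R0: "0 \<le> R" by (simp add: R_def)
      \<comment> \<open>The increment of the antiderivative is a difference of roots; rationalizing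
        the numerator gives the quotient in the definition of \<open>phi\<close>.\<close>
      have "(R - \<eta>) * (\<eta> + R) = 2 * \<epsilon> * (2 * \<epsilon>)"
        using R2 by (simp add: power2_eq_square algebra_simps)
      then have "(R - \<eta>) / (2 * \<epsilon>) = 2 * \<epsilon> / (\<eta> + R)"
        using False R0 \<eta> by (subst frac_eq_eq) (auto simp: mult_ac)
      then show ?thesis using False \<eta> by (simp add: phi_def R_def[symmetric] diff_divide_distrib)
    qed
  qed
qed

text \<open>If the estimate failed arbitrarily close to 0, a sequence of failures would have a
  subsequence along which the difference quotients converge to the diagonal for some eigenbasis.
  There \<open>bound\<close> applies, and the slack \<delta> absorbs the remaining error. As the
  eigenbasis cannot be prescribed, \<open>bound\<close> is required for all of them.\<close>

lemma Q_norm_eigenvalue_increment_at_0: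
  assumes Q: "Q_norm N \<nu>"
    and A: "A \<in> carrier_mat N N" "mat_adjoint A = A"
    and V: "V \<in> carrier_mat N N" "mat_adjoint V = V"
    and bound: "\<And>U. unitary_mat N U \<Longrightarrow> mat_adjoint U * A * U = diag_of_vec (eig_vec A) \<Longrightarrow>
      \<nu> (mat_diag N (\<lambda>i. of_real (Re ((mat_adjoint U * V * U) $$ (i,i))))) \<le> c"
    and \<delta>: "0 < \<delta>"
  shows "\<forall>\<^sub>F h in at 0. \<nu> (mat_diag N (\<lambda>i. of_real (eig_vec (A + of_real h \<cdot>\<^sub>m V) $ i - eig_vec A $ i)))
    \<le> (c + \<delta>) * \<bar>h\<bar>" (is "\<forall>\<^sub>F h in at 0. ?P h")
proof (rule sequentially_imp_eventually_at, intro allI impI, rule ccontr)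
  have inv: "unitarily_invariant_norm N \<nu>" using Q by (simp add: Q_norm_def)
  note \<nu> = unitarily_invariant_normD[OF inv]
  fix h :: "nat \<Rightarrow> real"
  assume h: "(\<forall>n. h n \<noteq> 0) \<and> h \<longlonglongrightarrow> 0"
    and neg: "\<not> (\<forall>\<^sub>F n in sequentially. ?P (h n))"
  have h0: "\<And>n. h n \<noteq> 0" and lim: "h \<longlonglongrightarrow> 0" using h by auto
  obtain q where q: "strict_mono (q :: nat \<Rightarrow> nat)" and nP: "\<And>n. \<not> ?P (h (q n))"
    using not_eventually_sequentiallyD[OF neg] by blast
  have hq: "(\<lambda>n. h (q n)) \<longlonglongrightarrow> 0" using LIMSEQ_subseq_LIMSEQ[OF lim q] by (simp add: o_def)
  have hq0: "h (q n) \<noteq> 0" for n using h0 by simp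
  obtain U r where U: "unitary_mat N U" "mat_adjoint U * A * U = diag_of_vec (eig_vec A)"
    and conv: "\<And>i. i < N \<Longrightarrow>
      (\<lambda>n. (eig_vec (A + of_real (h (q (r n))) \<cdot>\<^sub>m V) $ i - eig_vec A $ i) / h (q (r n)))
        \<longlonglongrightarrow> Re ((mat_adjoint U * V * U) $$ (i,i))"
    by (rule eigenvalue_derivative_subseq[OF A V hq hq0]) blast
  define k where "k n = h (q (r n))" for n
  have k0: "k n \<noteq> 0" for n using h0 by (simp add: k_def)
  define e where "e n i = eig_vec (A + of_real (k n) \<cdot>\<^sub>m V) $ i - eig_vec A $ i" for n i
  define d where "d i = Re ((mat_adjoint U * V * U) $$ (i,i))" for i
  let ?B = "\<lambda>i. \<nu> (mat_diag N (\<lambda>j. if j = i then 1 else 0))"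
  \<comment> \<open>Entrywise convergence of the quotients makes this majorant of the norm of the
    error tend to 0, so one index already contradicts the failure.\<close>
  have "(\<lambda>n. \<Sum>i<N. cmod (of_real (e n i / k n - d i)) * ?B i) \<longlonglongrightarrow> (\<Sum>i<N. cmod (of_real (d i - d i)) * ?B i)"
    using conv by (intro tendsto_intros) (auto simp: e_def k_def d_def)
  then have "\<forall>\<^sub>F n in sequentially. (\<Sum>i<N. cmod (of_real (e n i / k n - d i)) * ?B i) < \<delta>"
    using \<delta> by (simp add: order_tendstoD(2))
  then obtain n where n: "(\<Sum>i<N. cmod (of_real (e n i / k n - d i)) * ?B i) < \<delta>"
    by (auto simp: eventually_sequentially)
  let ?D = "\<lambda>f. mat_diag N (\<lambda>i. complex_of_real (f i))"
  have "?D (e n) = of_real (k n) \<cdot>\<^sub>m (?D d + ?D (\<lambda>i. e n i / k n - d i))"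
  proof -
    have "e n i = k n * (d i + (e n i / k n - d i))" for i using k0[of n] by simp
    then have "complex_of_real (e n i) = of_real (k n) * (of_real (d i) + of_real (e n i / k n - d i))" for i
      by (simp only: of_real_mult[symmetric] of_real_add[symmetric])
    then show ?thesis by (intro eq_matI) (auto simp only: mat_diag_def smult_mat_def map_mat_def
      plus_mat_def dim_row_mat dim_col_mat index_mat split if_True if_False mult_zero_right add_0_right split: if_split)
  qed
  then have "\<nu> (?D (e n)) = \<bar>k n\<bar> * \<nu> (?D d + ?D (\<lambda>i. e n i / k n - d i))"
    by (simp add: \<nu>(3))
  also have "\<dots> \<le> \<bar>k n\<bar> * (\<nu> (?D d) + \<nu> (?D (\<lambda>i. e n i / k n - d i)))"
    by (intro mult_left_mono \<nu>(4)) auto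
  also have "\<dots> \<le> \<bar>k n\<bar> * (c + \<delta>)"
  proof (intro mult_left_mono add_mono)
    show "\<nu> (?D d) \<le> c" unfolding d_def by (rule bound[OF U])
    show "\<nu> (?D (\<lambda>i. e n i / k n - d i)) \<le> \<delta>"
      using norm_mat_diag_le_sum[OF inv, of "\<lambda>i. of_real (e n i / k n - d i)"] n by linarith
  qed simp
  finally have "?P (k n)" by (simp add: e_def mult.commute)
  then show False using nP by (simp add: k_def)
qed

theorem theorem3p1:
  fixes m n N :: nat
    and H\<^sub>1 H\<^sub>2 E A A' V :: "complex mat"
    and \<epsilon>\<^sub>2 \<eta> :: real
    and normQ :: "complex mat \<Rightarrow> real"
  assumes "m \<ge> 1" and "n \<ge> 1" and "N = m + n"
    and "H\<^sub>1 \<in> carrier_mat m m" and "hermitian_mat H\<^sub>1"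
    and "H\<^sub>2 \<in> carrier_mat n n" and "hermitian_mat H\<^sub>2"
    and "E \<in> carrier_mat n m"
    and "A = four_block_mat H\<^sub>1 (mat_adjoint E) E H\<^sub>2"
    and "A' = four_block_mat H\<^sub>1 (0\<^sub>m m n) (0\<^sub>m n m) H\<^sub>2"
    and "V = A - A'"
    and "\<epsilon>\<^sub>2 = spectral_norm E"
    and "\<eta> = eig_gap H\<^sub>1 H\<^sub>2"
    and "Q_norm N normQ"
  shows "normQ (diag_of_vec (eig_vec A - eig_vec A')) \<le> phi \<eta> \<epsilon>\<^sub>2 * normQ V"
proof -
  have m: "m > 0" and n: "n > 0" using assms(1,2) by auto
  note H1 = assms(4) hermitian_matD[OF assms(5,4)]
  note H2 = assms(6) hermitian_matD[OF assms(7,6)]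
  note E = assms(8) and Q = assms(14)
  have inv: "unitarily_invariant_norm N normQ" using Q by (simp add: Q_norm_def)
  note \<nu> = unitarily_invariant_normD[OF inv]
  have V_eq: "V = four_block_mat (0\<^sub>m m m) (mat_adjoint E) E (0\<^sub>m n n)"
    unfolding assms(9-11) using H1 H2 E by (intro eq_matI) auto
  have V: "V \<in> carrier_mat N N" using E by (simp add: V_eq assms(3))
  have Vh: "mat_adjoint V = V"
    unfolding V_eq mat_adjoint_four_block[OF zero_carrier_mat mat_adjoint_carrier[OF E] E zero_carrier_mat]
    using E by (intro cong_four_block_mat) (auto intro!: eq_matI)
  have A': "A' \<in> carrier_mat N N" using H1 H2 by (simp add: assms(3,10))
  have A'h: "mat_adjoint A' = A'"
    unfolding assms(10) mat_adjoint_four_block[OF H1(1) zero_carrier_mat zero_carrier_mat H2(1)]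
    using H1 H2 by (intro cong_four_block_mat) (auto intro!: eq_matI)
  define P where "P t = A' + of_real t \<cdot>\<^sub>m V" for t :: real
  have Pc: "P t \<in> carrier_mat N N" for t using A' V by (simp add: P_def)
  have Ph: "mat_adjoint (P t) = P t" for t
    unfolding P_def by (rule mat_adjoint_add_smult[OF A' A'h V Vh])
  \<comment> \<open>The path is affine, so its behaviour near any t is that of a perturbation of
    \<open>P t\<close> by a small multiple of \<open>V\<close>.\<close>
  have P_shift: "P (h + t) = P t + of_real h \<cdot>\<^sub>m V" for h t
    using A' V by (intro eq_matI) (auto simp: P_def algebra_simps)
  have P0: "P 0 = A'" using A' V by (intro eq_matI) (auto simp: P_def)
  have Ac: "A \<in> carrier_mat N N" using H1 H2 by (simp add: assms(3,9))
  have P1: "P 1 = A" using A' Ac by (intro eq_matI) (auto simp: P_def assms(11))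
  have dimP: "dim_vec (eig_vec (P t)) = N" for t
    by (rule hermitian_eig_vec[OF Pc[of t] Ph[of t]])
  let ?G = "{cmod (\<mu> - \<nu>) |\<mu> \<nu>. \<mu> \<in># eig H\<^sub>1 \<and> \<nu> \<in># eig H\<^sub>2}"
  have G: "?G = (\<lambda>(\<mu>,\<nu>). cmod (\<mu> - \<nu>)) ` (set_mset (eig H\<^sub>1) \<times> set_mset (eig H\<^sub>2))" by auto
  have finG: "finite ?G" unfolding G by simp
  \<comment> \<open>Nonempty spectra make the minimum in \<open>eig_gap\<close> an actual distance,
    from which its nonnegativity follows.\<close>
  have ne: "eig H \<noteq> {#}" if H: "H \<in> carrier_mat k k" "mat_adjoint H = H" and k: "k > 0" for H k
  proof -
    obtain U where "unitary_mat k U" "mat_adjoint U * H * U = diag_of_vec (eig_vec H)"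
      "dim_vec (eig_vec H) = k"
      by (rule hermitian_eig_vec[OF H])
    then show ?thesis using eig_unitary_diag[OF H(1)] k by (simp add: diag_of_vec_def mset_set_empty_iff)
  qed
  have "?G \<noteq> {}" unfolding G using ne[OF H1 m] ne[OF H2 n] by auto
  then have "\<eta> \<in> ?G" unfolding assms(13) eig_gap_def by (rule Min_in[OF finG])
  then have \<eta>: "0 \<le> \<eta>" by auto
  have gap: "\<eta> \<le> cmod (\<mu> - \<nu>)" if "\<mu> \<in># eig H\<^sub>1" "\<nu> \<in># eig H\<^sub>2" for \<mu> \<nu>
    unfolding assms(13) eig_gap_def by (rule Min_le[OF finG]) (use that in auto)
  have \<epsilon>: "0 \<le> \<epsilon>\<^sub>2" unfolding assms(12) by (rule spectral_norm_nonneg[OF E m])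
  obtain F f where deriv: "\<And>t. 0 \<le> t \<Longrightarrow> (F has_real_derivative f t) (at t)"
    and f0: "\<And>t. 0 \<le> t \<Longrightarrow> 0 \<le> f t"
    and f: "\<And>t r q. 0 \<le> t \<Longrightarrow> r\<^sup>2 \<le> q \<Longrightarrow>
      r\<^sup>2 * (\<eta>\<^sup>2 + 4 * t\<^sup>2 * \<epsilon>\<^sub>2\<^sup>2) \<le> 4 * t\<^sup>2 * \<epsilon>\<^sub>2\<^sup>2 * q \<Longrightarrow> r\<^sup>2 \<le> (f t)\<^sup>2 * q"
    and F: "F 1 - F 0 = phi \<eta> \<epsilon>\<^sub>2"
    using phi_antiderivative[OF \<eta> \<epsilon>] by blast
  let ?D = "\<lambda>x. mat_diag N (\<lambda>i. complex_of_real (x i))"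
  \<comment> \<open>\<open>g\<close> measures the displacement of the whole sorted spectrum. Entries
    of equal index are compared, so the norm axioms make it symmetric and subadditive.\<close>
  define g where "g s t = normQ (?D (\<lambda>i. eig_vec (P t) $ i - eig_vec (P s) $ i))" for s t
  have "g 0 1 \<le> F 1 * normQ V - F 0 * normQ V"
  proof (rule increment_le_integral[where F = "\<lambda>t. F t * normQ V" and f = "\<lambda>t. f t * normQ V"])
    fix s t r :: real
    have "?D (\<lambda>i. eig_vec (P s) $ i - eig_vec (P s) $ i) = 0\<^sub>m N N"
      by (intro eq_matI) (auto simp: mat_diag_def)
    then show "g s s = 0" unfolding g_def by (simp only: \<nu>(2))
    have "?D (\<lambda>i. eig_vec (P t) $ i - eig_vec (P s) $ i) =
        (-1) \<cdot>\<^sub>m ?D (\<lambda>i. eig_vec (P s) $ i - eig_vec (P t) $ i)"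
      by (intro eq_matI) (auto simp: mat_diag_def)
    then show "g s t = g t s" unfolding g_def by (simp add: \<nu>(3))
    have "?D (\<lambda>i. eig_vec (P t) $ i - eig_vec (P r) $ i) =
        ?D (\<lambda>i. eig_vec (P s) $ i - eig_vec (P r) $ i) + ?D (\<lambda>i. eig_vec (P t) $ i - eig_vec (P s) $ i)"
      by (intro eq_matI) (auto simp: mat_diag_def)
    then show "g r t \<le> g r s + g s t" unfolding g_def by (simp add: \<nu>(4))
  next
    fix t :: real assume t: "0 \<le> t" "t \<le> 1"
    show "((\<lambda>t. F t * normQ V) has_real_derivative f t * normQ V) (at t)"
      by (rule DERIV_cmult_right[OF deriv[OF t(1)]])
    fix \<delta> :: real assume \<delta>: "0 < \<delta>"
    have "normQ (?D (\<lambda>i. Re ((mat_adjoint U * V * U) $$ (i,i)))) \<le> f t * normQ V"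
      if U: "unitary_mat N U" and D: "mat_adjoint U * P t * U = diag_of_vec (eig_vec (P t))" for U
    proof (rule Q_norm_diag_le[OF Q V U f0[OF t(1)]])
      fix i assume i: "i < N"
      have D': "mat_adjoint U * P t * U = mat_diag N (\<lambda>i. of_real (eig_vec (P t) $ i))"
        unfolding D diag_of_vec_def dimP ..
      show "(Re ((mat_adjoint U * V * U) $$ (i,i)))\<^sup>2 \<le> (f t)\<^sup>2 * (vec_norm2 (V *\<^sub>v col U i))\<^sup>2"
      proof (rule f[OF t(1) Rayleigh_le_image_norm[OF V U i]])
        show "(Re ((mat_adjoint U * V * U) $$ (i,i)))\<^sup>2 * (\<eta>\<^sup>2 + 4 * t\<^sup>2 * \<epsilon>\<^sub>2\<^sup>2) \<le>
            4 * t\<^sup>2 * \<epsilon>\<^sub>2\<^sup>2 * (vec_norm2 (V *\<^sub>v col U i))\<^sup>2"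
          unfolding assms(12)
          by (rule off_diagonal_eigenbasis_bound[OF H1 H2 E m gap \<eta> U[unfolded assms(3)] V_eq
                D'[unfolded P_def assms(3,10)] i[unfolded assms(3)]])
      qed
    qed
    \<comment> \<open>The estimate at 0 is applied with \<open>P t\<close> as the unperturbed matrix
      and then translated back to the point t of the path.\<close>
    from Q_norm_eigenvalue_increment_at_0[OF Q Pc Ph V Vh this \<delta>]
    show "\<forall>\<^sub>F s in at t. g t s \<le> (f t * normQ V + \<delta>) * \<bar>s - t\<bar>"
      unfolding eventually_at_to_0[of _ t] g_def P_shift by simp
  qed simp
  also have "\<dots> = phi \<eta> \<epsilon>\<^sub>2 * normQ V" by (simp add: F[symmetric] algebra_simps)
  also have "g 0 1 = normQ (diag_of_vec (eig_vec A - eig_vec A'))"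
  proof -
    have dims: "dim_vec (eig_vec A) = N" "dim_vec (eig_vec A') = N"
      using dimP[of 1] dimP[of 0] by (auto simp: P0 P1)
    have "?D (\<lambda>i. eig_vec A $ i - eig_vec A' $ i) = diag_of_vec (eig_vec A - eig_vec A')"
      unfolding diag_of_vec_def index_minus_vec(2) dims by (rule mat_diag_cong) (simp add: dims)
    then show ?thesis by (simp add: g_def P0 P1)
  qed
  finally show ?thesis .
qed

end
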